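(* Let $P,Q\in K(x)$ satisfy Condition (M) (stated in the context), let $k$ be the number of zeros of $P'$, $p=\deg P$, $q=\deg Q$. Let $f,g\in\mathcal A(K)$ be non-constant entire functions with $P(f)=Q(g)$, and let $t:=\nu(f)=\nu(g)$ be their (common) ramification index. Then, for all $\rho\in[\rho_0,\infty[$ (where $\rho_0>0$), $$0\;\geq\;\frac{kq-p}{\chi^t q}\,T(\rho,f)+\log\rho+O(1),$$ where $O(1)$ denotes a bounded function of $\rho$; i.e., $qk-p<0$.
   Context: $K$ is an algebraically closed field of characteristic $\pi$ (possibly $0$), complete with respect to a non-archimedean absolute value $|\cdot|$. $\mathcal A(K)$ is the ring of entire functions on $K$ (power series converging on all of $K$) and $\mathcal M(K)$ is its field of fractions (meromorphic functions on $K$). Characteristic exponent and ramification index: $\chi:=\pi$ if $\pi\neq0$, and $\chi:=1$ if $\pi=0$. If $\pi\ne 0$, the ramification index $\nu(h)$ of a non-constant $h\in\mathcal M(K)$ is the unique integer $t\ge0$ such that $\sqrt[\chi^t]{h}\in\mathcal M(K)$ and $(\sqrt[\chi^t]{h})'\neq0$; if $\pi=0$, $\nu(h)=0$. For $f,g$ as in the claim one has $\nu(f)=\nu(g)$. Nevanlinna function: for a function $h$ having neither a zero nor a pole at $0$ (a standing assumption for every function to which $T$ is applied), let $w_\alpha(h)=n$ if $h$ has a zero of order $n$ at $\alpha$ and $w_\alpha(h)=-n$ if $h$ has a pole of order $n$ at $\alpha$. Put $Z(\rho,h)=\sum_{w_\alpha(h)>0,\,|\alpha|\le\rho}w_\alpha(h)\log\frac{\rho}{|\alpha|}$,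 $N(\rho,h)=Z(\rho,1/h)$, $T(\rho,h)=\max\{Z(\rho,h),N(\rho,h)\}$. Degrees: write $P=R/S$, $Q=V/W$ with $R,S,V,W\in K[x]$, $\gcd(R,S)=1$, $\gcd(V,W)=1$; $\deg P=\max\{\deg R,\deg S\}$, $\deg Q=\max\{\deg V,\deg W\}$. Condition (M) on $P,Q\in K(x)$: denote by $c_1,\dots,c_k$ the (distinct) zeros of $P'$ in $K$ (the condition presupposes that the values $P(c_i)\in K$ are defined). Then (1) $P'Q'\neq0$; (2) $P=R/S$ with $\gcd(R,S)=1$, $Q=V/W$ with $V,W$ monic and $\gcd(V,W)=1$, where $R,S,V,W\in K[x]$; (3) $k>0$, and for every $i\in\{1,\dots,k\}$ and every zero $d$ of $V'-P(c_i)W'$ one has $W(d)\neq0$ and $Q(d)\neq P(c_i)$; (4) $P(c_i)\neq P(c_j)$ whenever $i\neq j$; (5) if $\deg V=\deg W$, then $P(c_i)\neq1$ for all $i\in\{1,\dots,k\}$. *)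

theory Defs
  imports
    "HOL-Analysis.Analysis"
    "HOL-Computational_Algebra.Computational_Algebra"
begin

section \<open>Complete non-archimedean fields\<close>

text \<open>The ground field is a type of class \<^class>\<open>alg_closed_field\<close>; its absolute value is an
  explicit function, since the norm classes of the library force characteristic 0.\<close>

locale complete_nonarch_field =
  fixes v :: "'k::alg_closed_field \<Rightarrow> real"
  assumes v_nonneg: "0 \<le> v x"
    and v_eq_0_iff: "v x = 0 \<longleftrightarrow> x = 0"
    and v_mult: "v (x * y) = v x * v y"
    and v_ultrametric: "v (x + y) \<le> max (v x) (v y)"
    and v_complete: "Metric_space.mcomplete UNIV (\<lambda>x y. v (x - y))"

definition char_exponent :: "'k::field itself \<Rightarrow> nat" where
  "char_exponent _ = (if CHAR('k) = 0 then 1 else CHAR('k))"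


section \<open>Entire and meromorphic functions\<close>

definition power_series_sums :: "('k::field \<Rightarrow> real) \<Rightarrow> 'k fps \<Rightarrow> 'k \<Rightarrow> 'k \<Rightarrow> bool" where
  "power_series_sums v a x s \<longleftrightarrow> (\<lambda>n. v ((\<Sum>i<n. fps_nth a i * x ^ i) - s)) \<longlonglongrightarrow> 0"

definition entire_functions :: "('k::field \<Rightarrow> real) \<Rightarrow> 'k fps set" where
  "entire_functions v = {a. \<forall>x. \<exists>s. power_series_sums v a x s}"

definition entire_value :: "('k::field \<Rightarrow> real) \<Rightarrow> 'k fps \<Rightarrow> 'k \<Rightarrow> 'k" where
  "entire_value v a x = (THE s. power_series_sums v a x s)"

text \<open>The field of fractions of the ring of entire functions, realised inside the field of
  formal Laurent series (the Laurent expansions at 0).\<close>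

definition meromorphic_functions :: "('k::field \<Rightarrow> real) \<Rightarrow> 'k fls set" where
  "meromorphic_functions v =
    {fps_to_fls a / fps_to_fls b | a b.
      a \<in> entire_functions v \<and> b \<in> entire_functions v \<and> b \<noteq> 0}"

text \<open>The order of a nonzero meromorphic function at a point: positive at a zero, negative at a
  pole.\<close>

definition order_at :: "('k::field \<Rightarrow> real) \<Rightarrow> 'k \<Rightarrow> 'k fls \<Rightarrow> int" where
  "order_at v \<alpha> h = (THE n. \<exists>a\<in>entire_functions v. \<exists>b\<in>entire_functions v.
     entire_value v a \<alpha> \<noteq> 0 \<and> entire_value v b \<alpha> \<noteq> 0 \<and>
     h = (fls_X - fls_const \<alpha>) powi n * (fps_to_fls a / fps_to_fls b))"

definition ramification_index :: "('k::field \<Rightarrow> real) \<Rightarrow> 'k fls \<Rightarrow> nat" where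
  "ramification_index v h =
    (if CHAR('k) = 0 then 0
     else (THE t. \<exists>u\<in>meromorphic_functions v.
             u ^ (char_exponent TYPE('k) ^ t) = h \<and> fls_deriv u \<noteq> 0))"


section \<open>Nevanlinna functions\<close>

text \<open>These are meant for functions with neither a zero nor a pole at 0.\<close>

definition nev_Z :: "('k::field \<Rightarrow> real) \<Rightarrow> real \<Rightarrow> 'k fls \<Rightarrow> real" where
  "nev_Z v \<rho> h =
    (\<Sum>\<alpha> | order_at v \<alpha> h > 0 \<and> v \<alpha> \<le> \<rho>. of_int (order_at v \<alpha> h) * ln (\<rho> / v \<alpha>))"

definition nev_N :: "('k::field \<Rightarrow> real) \<Rightarrow> real \<Rightarrow> 'k fls \<Rightarrow> real" where
  "nev_N v \<rho> h = nev_Z v \<rho> (1 / h)"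

definition nev_T :: "('k::field \<Rightarrow> real) \<Rightarrow> real \<Rightarrow> 'k fls \<Rightarrow> real" where
  "nev_T v \<rho> h = max (nev_Z v \<rho> h) (nev_N v \<rho> h)"


section \<open>Rational functions\<close>

definition rat_reduced :: "'k::field poly fract \<Rightarrow> 'k poly \<times> 'k poly" where
  "rat_reduced P = (THE (R, S). P = Fract R S \<and> coprime R S \<and> lead_coeff S = 1)"

definition rat_num :: "'k::field poly fract \<Rightarrow> 'k poly" where
  "rat_num P = fst (rat_reduced P)"

definition rat_den :: "'k::field poly fract \<Rightarrow> 'k poly" where
  "rat_den P = snd (rat_reduced P)"

lemma rat_reduced_ex1:
  fixes P :: "'k::field poly fract"
  shows "\<exists>!(R, S). P = Fract R S \<and> coprime R S \<and> lead_coeff S = 1"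
proof -
  define D where "D S \<longleftrightarrow> S \<noteq> 0 \<and> (\<exists>R. P = Fract R S)" for S :: "'k poly"
  obtain S0 where "D S0"
    unfolding D_def by (cases P) auto
  then obtain S where S: "D S" and minimal: "\<And>S'. D S' \<Longrightarrow> degree S \<le> degree S'"
    using ex_has_least_nat[of D S0 degree] by blast
  obtain R where S0: "S \<noteq> 0" and R: "P = Fract R S"
    using S unfolding D_def by blast
  have cop: "coprime R S"
  proof (rule coprimeI)
    fix c assume "c dvd R" "c dvd S"
    then obtain r s where rs: "R = c * r" "S = c * s" by (auto elim!: dvdE)
    have nz: "c \<noteq> 0" "s \<noteq> 0" using S0 rs by auto
    have "D s"
      unfolding D_def using nz R rs by (auto simp: eq_fract intro!: exI[of _ r])
    then have "degree c = 0"
      using minimal[of s] nz rs by (simp add: degree_mult_eq)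
    then show "is_unit c" using nz by (simp add: is_unit_iff_degree)
  qed
  define l where "l = inverse (lead_coeff S)"
  have l: "l \<noteq> 0" using S0 by (simp add: l_def)
  have 1: "P = Fract (smult l R) (smult l S)"
    using R S0 l by (simp add: eq_fract mult.commute)
  have 2: "coprime (smult l R) (smult l S)"
    using cop l by (simp add: coprime_iff_gcd_eq_1 coprime_def dvd_smult_iff)
  have 3: "lead_coeff (smult l S) = 1"
    using S0 by (simp add: l_def)
  show ?thesis
  proof (rule ex1I[of _ "(smult l R, smult l S)"])
    show "case (smult l R, smult l S) of (R, S) \<Rightarrow> P = Fract R S \<and> coprime R S \<and> lead_coeff S = 1"
      using 1 2 3 by simp
  next
    fix x :: "'k poly \<times> 'k poly"
    assume "case x of (R, S) \<Rightarrow> P = Fract R S \<and> coprime R S \<and> lead_coeff S = 1"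
    then obtain A B where x: "x = (A, B)" and AB: "P = Fract A B" "coprime A B" "lead_coeff B = 1"
      by (cases x) auto
    have B0: "B \<noteq> 0" using AB(3) by auto
    have eq: "A * S = R * B"
      using AB(1) R S0 B0 by (simp add: eq_fract)
    define m where "m = B div S"
    have eq': "(A - R * m) * S = R * (B mod S)"
      using eq by (simp add: m_def algebra_simps minus_mult_div_eq_mod [symmetric])
    have "B mod S = 0"
    proof (rule ccontr)
      assume nz: "B mod S \<noteq> 0"
      then have "D (B mod S)"
        unfolding D_def using R S0 eq' by (auto simp: eq_fract intro!: exI[of _ "A - R * m"])
      then show False
        using minimal[of "B mod S"] degree_mod_less'[OF S0 nz] by simp
    qed
    then have Bm: "B = S * m" and Am: "A = R * m"
      using eq' S0 by (auto simp: m_def)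
    have "is_unit m"
      using AB(2) Am Bm by (auto intro: coprime_common_divisor)
    then obtain u where u: "m = [:u:]" by (auto elim: is_unit_polyE)
    have "lead_coeff S * u = 1"
      using AB(3) unfolding Bm by (cases "u = 0") (auto simp: lead_coeff_mult u mult.commute split: if_splits)
    then have "u = l"
      using S0 by (simp add: l_def field_simps)
    then show "x = (smult l R, smult l S)" by (simp add: x Am Bm u)
  qed
qed

definition rat_degree :: "'k::field poly fract \<Rightarrow> nat" where
  "rat_degree P = max (degree (rat_num P)) (degree (rat_den P))"

definition rat_regular_at :: "'k::field poly fract \<Rightarrow> 'k \<Rightarrow> bool" where
  "rat_regular_at P c \<longleftrightarrow> poly (rat_den P) c \<noteq> 0"

definition rat_value :: "'k::field poly fract \<Rightarrow> 'k \<Rightarrow> 'k" where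
  "rat_value P c = poly (rat_num P) c / poly (rat_den P) c"

definition rat_deriv :: "'k::field poly fract \<Rightarrow> 'k poly fract" where
  "rat_deriv P =
    Fract (pderiv (rat_num P) * rat_den P - rat_num P * pderiv (rat_den P)) ((rat_den P)\<^sup>2)"

definition rat_zeros :: "'k::field poly fract \<Rightarrow> 'k set" where
  "rat_zeros P = {c. rat_regular_at P c \<and> rat_value P c = 0}"

text \<open>The composition \<open>P(h)\<close>; the denominator does not vanish when \<open>h\<close> is non-constant.\<close>

definition rat_compose :: "'k::field poly fract \<Rightarrow> 'k fls \<Rightarrow> 'k fls" where
  "rat_compose P h =
    poly (map_poly fls_const (rat_num P)) h / poly (map_poly fls_const (rat_den P)) h"

text \<open>The zeros of \<open>P'\<close> are required to lie outside the poles of \<open>P\<close>. This is not automatic in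
  positive characteristic: for \<open>P = 1 / x ^ p + x ^ 3\<close> in characteristic \<open>p > 3\<close> the point 0 is
  both a pole of \<open>P\<close> and a zero of \<open>P'\<close>.\<close>

definition condition_M :: "'k::field poly fract \<Rightarrow> 'k poly fract \<Rightarrow> bool" where
  "condition_M P Q \<longleftrightarrow>
    (let C = rat_zeros (rat_deriv P) in
      (\<forall>c\<in>C. rat_regular_at P c) \<and>
      rat_deriv P * rat_deriv Q \<noteq> 0 \<and>
      (\<exists>R S V W.
         P = Fract R S \<and> S \<noteq> 0 \<and> coprime R S \<and>
         Q = Fract V W \<and> lead_coeff V = 1 \<and> lead_coeff W = 1 \<and> coprime V W \<and>
         card C > 0 \<and>
         (\<forall>c\<in>C. \<forall>d. poly (pderiv V - smult (rat_value P c) (pderiv W)) d = 0 \<longrightarrow>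
            poly W d \<noteq> 0 \<and> rat_value Q d \<noteq> rat_value P c) \<and>
         inj_on (rat_value P) C \<and>
         (degree V = degree W \<longrightarrow> (\<forall>c\<in>C. rat_value P c \<noteq> 1))))"

end

theory Submission
  imports Defs
begin

unbundle no vec_syntax
unbundle fps_syntax

text \<open>Work with the Gauss norms \<open>\<bar>h\<bar>\<^sub>r = max\<^sub>n \<bar>h\<^sub>n\<bar> r\<^sup>n\<close> instead of the counting functions. They are multiplicative,
  satisfy \<open>\<bar>h'\<bar>\<^sub>r \<le> \<bar>h\<bar>\<^sub>r / r\<close>, and Condition (M) enters through divisibility in the ring of entire functions.
  Write \<open>f(x) = F(x\<^sup>n)\<close>, \<open>g(x) = G(x\<^sup>n)\<close> with \<open>n = \<chi>\<^sup>t\<close>; then \<open>P(F) = Q(G)\<close> and \<open>F'\<close>, \<open>G'\<close> are nonzero.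
  Since \<open>(x - c)\<^sup>2\<close> divides \<open>R - P(c) S\<close> and \<open>V - P(c) W\<close> is squarefree for every zero \<open>c\<close> of \<open>P'\<close>,
  each \<open>F - c\<close> divides \<open>G'\<close>. These factors are pairwise coprime, so their product divides \<open>G'\<close> and
  \<open>r \<bar>F\<bar>\<^sub>r\<^sup>k = O(\<bar>G\<bar>\<^sub>r)\<close>. Since \<open>V(G)\<close> divides \<open>R(F)\<close> and \<open>W(G)\<close> divides \<open>S(F)\<close>, also
  \<open>\<bar>G\<bar>\<^sub>r\<^sup>q = O(\<bar>F\<bar>\<^sub>r\<^sup>p)\<close>. Together \<open>r\<^sup>q \<bar>F\<bar>\<^sub>r\<^sup>k\<^sup>q = O(\<bar>F\<bar>\<^sub>r\<^sup>p)\<close>, which forces \<open>k q < p\<close> because \<open>\<bar>F\<bar>\<^sub>r\<close> is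
  unbounded. What remains is a lower bound for \<open>T(\<rho>, f)\<close>, and this only needs enough zeros of \<open>f\<close>: a
  polynomial has as many as its degree, and any other entire function has infinitely many.\<close>

context complete_nonarch_field
begin

section \<open>Ultrametric inequalities and completeness\<close>

lemma v_0 [simp]: "v 0 = 0"
  by (simp add: v_eq_0_iff)

lemma v_pos: "x \<noteq> 0 \<Longrightarrow> 0 < v x"
  using v_nonneg[of x] v_eq_0_iff[of x] by linarith

lemma v_1 [simp]: "v 1 = 1"
proof -
  have "v 1 * v 1 = v 1"
    using v_mult[of 1 1] by simp
  then show ?thesis
    using v_eq_0_iff[of 1] by auto
qed

lemma v_power: "v (x ^ n) = v x ^ n"
  by (induction n) (simp_all add: v_mult)

lemma v_minus [simp]: "v (- x) = v x"
proof -
  have "v (-1) ^ 2 = 1"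
    by (simp flip: v_power)
  then have "v (-1) = 1"
    using v_nonneg[of "-1"] by (simp add: power2_eq_1_iff)
  then show ?thesis
    using v_mult[of "-1" x] by simp
qed

lemma v_minus_commute: "v (x - y) = v (y - x)"
  using v_minus[of "x - y"] by simp

lemma v_inverse: "v (inverse x) = inverse (v x)"
proof (cases "x = 0")
  case False
  then have "v x * v (inverse x) = 1"
    by (simp flip: v_mult)
  then show ?thesis
    by (metis inverse_unique)
qed simp

lemma v_divide: "v (x / y) = v x / v y"
  by (simp add: divide_inverse v_mult v_inverse)

lemma v_diff: "v (x - y) \<le> max (v x) (v y)"
  using v_ultrametric[of x "- y"] by simp

lemma v_diff_trans: "v (x - z) \<le> max (v (x - y)) (v (y - z))"
  using v_ultrametric[of "x - y" "y - z"] by simp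

text \<open>The isosceles principle: \<open>y = (x + y) - x\<close>, so \<open>v y\<close> is at
  most the larger of \<open>v (x + y)\<close> and \<open>v x\<close>, and the second is too
  small.\<close>

lemma v_add_eq: "v x < v y \<Longrightarrow> v (x + y) = v y"
  using v_ultrametric[of x y] v_diff[of "x + y" x] by simp

lemma v_sum_le:
  assumes "\<And>i. i \<in> S \<Longrightarrow> v (f i) \<le> B" "0 \<le> B"
  shows "v (\<Sum>i\<in>S. f i) \<le> B"
  using assms
proof (induction S rule: infinite_finite_induct)
  case (insert x F)
  then have "max (v (f x)) (v (sum f F)) \<le> B"
    by auto
  then have "v (f x + sum f F) \<le> B"
    using v_ultrametric[of "f x" "sum f F"] by linarith
  then show ?case
    using insert(1,2) by simp
qed auto

lemma v_sum_less:
  assumes "\<And>i. i \<in> S \<Longrightarrow> v (f i) < B" "0 < B"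
  shows "v (\<Sum>i\<in>S. f i) < B"
  using assms
proof (induction S rule: infinite_finite_induct)
  case (insert x F)
  then have "max (v (f x)) (v (sum f F)) < B"
    by auto
  then have "v (f x + sum f F) < B"
    using v_ultrametric[of "f x" "sum f F"] by linarith
  then show ?case
    using insert(1,2) by simp
qed auto

lemma v_of_nat_le: "v (of_nat n) \<le> 1"
proof (induction n)
  case (Suc n)
  then show ?case
    using v_ultrametric[of 1 "of_nat n"] by simp
qed simp

lemma v_limit_unique:
  assumes "(\<lambda>n. v (s n - x)) \<longlonglongrightarrow> 0" "(\<lambda>n. v (s n - y)) \<longlonglongrightarrow> 0"
  shows "x = y"
proof -
  have "(\<lambda>n. v (s n - x) + v (s n - y)) \<longlonglongrightarrow> 0 + 0"
    using assms by (intro tendsto_add)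
  moreover have "v (x - y) \<le> v (s n - x) + v (s n - y)" for n
    using v_diff_trans[of x y "s n"] v_nonneg[of "s n - x"] v_nonneg[of "s n - y"]
    by (simp add: v_minus_commute[of x "s n"])
  ultimately have "v (x - y) \<le> 0"
    by (intro LIMSEQ_le_const[where X = "\<lambda>n. v (s n - x) + v (s n - y)"]) auto
  then show ?thesis
    using v_pos[of "x - y"] by force
qed

lemma v_Metric_space: "Metric_space UNIV (\<lambda>x y. v (x - y))"
proof
  show "v (x - z) \<le> v (x - y) + v (y - z)" for x y z
    using v_diff_trans[of x z y] v_nonneg[of "x - y"] v_nonneg[of "y - z"] by linarith
qed (auto simp: v_nonneg v_eq_0_iff v_minus_commute)

text \<open>By the ultrametric inequality, small consecutive differences keep all later terms within
  \<open>e\<close> of one fixed \<open>s N\<close>, so the sequence is Cauchy.\<close>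

lemma v_seq_convergent:
  assumes "(\<lambda>n. v (s (Suc n) - s n)) \<longlonglongrightarrow> 0"
  shows "\<exists>l. (\<lambda>n. v (s n - l)) \<longlonglongrightarrow> 0"
proof -
  interpret M: Metric_space UNIV "\<lambda>x y. v (x - y)"
    by (rule v_Metric_space)
  have "M.MCauchy s"
    unfolding M.MCauchy_def
  proof (intro conjI allI impI)
    fix e :: real assume e: "e > 0"
    then have "eventually (\<lambda>n. v (s (Suc n) - s n) < e) sequentially"
      using assms order_tendstoD(2) by blast
    then obtain N where N: "\<And>n. n \<ge> N \<Longrightarrow> v (s (Suc n) - s n) < e"
      by (auto simp: eventually_sequentially)
    have N': "v (s n - s N) < e" if "n \<ge> N" for n
      using that
    proof (induction n rule: dec_induct)
      case (step n)
      then show ?case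
        using N[of n] v_diff_trans[of "s (Suc n)" "s N" "s n"] by simp
    qed (use e in simp)
    show "\<exists>N. \<forall>n n'. N \<le> n \<longrightarrow> N \<le> n' \<longrightarrow> v (s n - s n') < e"
    proof (intro exI allI impI)
      fix n n' assume "N \<le> n" "N \<le> n'"
      then show "v (s n - s n') < e"
        using N'[of n] N'[of n'] v_diff_trans[of "s n" "s n'" "s N"]
        by (simp add: v_minus_commute[of "s N"])
    qed
  qed simp
  then obtain l where "limitin M.mtopology s l sequentially"
    using v_complete unfolding M.mcomplete_def by blast
  then show ?thesis
    by (auto simp: M.limitin_metric_dist_null)
qed

section \<open>The ring of entire functions\<close>

abbreviation \<A> :: "'k fps set" where
  "\<A> \<equiv> entire_functions v"

text \<open>If the absolute value is trivial, then \<open>entire_functions v\<close> consists of the polynomials;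
  the growth condition below covers this case as well.\<close>

lemma v_coeff_tendsto_0:
  assumes "a \<in> \<A>" "r > 0"
  shows "(\<lambda>n. v (a $ n) * r ^ n) \<longlonglongrightarrow> 0"
proof -
  have lim: "(\<lambda>n. v (a $ n) * v x ^ n) \<longlonglongrightarrow> 0" for x
  proof -
    obtain s where s: "(\<lambda>n. v ((\<Sum>i<n. a $ i * x ^ i) - s)) \<longlonglongrightarrow> 0"
      using assms(1) unfolding entire_functions_def power_series_sums_def by blast
    have lim2: "(\<lambda>n. v ((\<Sum>i<Suc n. a $ i * x ^ i) - s) + v ((\<Sum>i<n. a $ i * x ^ i) - s)) \<longlonglongrightarrow> 0"
      using tendsto_add[OF LIMSEQ_Suc[OF s] s] by simp
    show ?thesis
    proof (rule tendsto_sandwich[OF _ _ tendsto_const lim2])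
      show "\<forall>\<^sub>F n in sequentially. 0 \<le> v (a $ n) * v x ^ n"
        by (simp add: v_nonneg)
      show "\<forall>\<^sub>F n in sequentially. v (a $ n) * v x ^ n
              \<le> v ((\<Sum>i<Suc n. a $ i * x ^ i) - s) + v ((\<Sum>i<n. a $ i * x ^ i) - s)"
      proof (intro always_eventually allI)
        fix n
        define t where "t = (\<Sum>i<n. a $ i * x ^ i)"
        have "v (a $ n * x ^ n) \<le> v (t + a $ n * x ^ n - s) + v (t - s)"
          using v_diff[of "t + a $ n * x ^ n - s" "t - s"] v_nonneg[of "t - s"]
            v_nonneg[of "t + a $ n * x ^ n - s"] by simp
        then show "v (a $ n) * v x ^ n
              \<le> v ((\<Sum>i<Suc n. a $ i * x ^ i) - s) + v ((\<Sum>i<n. a $ i * x ^ i) - s)"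
          by (simp add: t_def v_mult v_power)
      qed
    qed
  qed
  show ?thesis
  \<comment> \<open>If some \<open>x\<close> lies outside the unit disc, its powers reach any radius
    \<open>r\<close>. Otherwise every nonzero element has absolute value 1, and coefficients of
    absolute value below 1 vanish.\<close>
  proof (cases "\<exists>x. v x > 1")
    case True
    then obtain x m where "v x ^ m > r"
      using real_arch_pow by blast
    then have x: "v (x ^ m) \<ge> r"
      by (simp add: v_power)
    show ?thesis
    proof (rule tendsto_sandwich[OF _ _ tendsto_const lim[of "x ^ m"]])
      show "\<forall>\<^sub>F n in sequentially. v (a $ n) * r ^ n \<le> v (a $ n) * v (x ^ m) ^ n"
        using x assms(2) by (intro always_eventually allI mult_left_mono power_mono v_nonneg) auto
    qed (use assms(2) in \<open>simp add: v_nonneg\<close>)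
  next
    case False
    have 1: "v x = 1" if "x \<noteq> 0" for x
    proof -
      have "v x \<le> 1" "inverse (v x) \<le> 1"
        using False by (auto simp: not_less simp flip: v_inverse)
      then show ?thesis
        using v_pos[OF that] by (simp add: field_simps)
    qed
    have "eventually (\<lambda>n. v (a $ n) < 1) sequentially"
      using lim[of 1] order_tendstoD(2) by fastforce
    then have "eventually (\<lambda>n. v (a $ n) * r ^ n = 0) sequentially"
      by eventually_elim (metis 1 less_irrefl mult_zero_left v_0)
    then show ?thesis
      by (rule tendsto_eventually)
  qed
qed

lemma entire_bounded:
  assumes "a \<in> \<A>" "r > 0"
  obtains C where "\<And>n. v (a $ n) * r ^ n \<le> C" "C \<ge> 0"
proof -
  have "Bseq (\<lambda>n. v (a $ n) * r ^ n)"
    using v_coeff_tendsto_0[OF assms] by (intro convergent_imp_Bseq convergentI)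
  then obtain C where C: "C > 0" "\<And>n. norm (v (a $ n) * r ^ n) \<le> C"
    unfolding Bseq_def by blast
  show ?thesis
  proof
    show "v (a $ n) * r ^ n \<le> C" for n
      using C(2)[of n] by (simp add: abs_le_iff)
  qed (use C in simp)
qed

text \<open>A bound on the terms at radius \<open>2 * r\<close> gives geometric decay at radius
  \<open>r\<close>, so the partial sums converge. Bounds at all radii pass through ring operations
  more easily than limits do.\<close>

lemma entireI:
  assumes "\<And>r. r > 0 \<Longrightarrow> \<exists>C. \<forall>n. v (a $ n) * r ^ n \<le> C"
  shows "a \<in> \<A>"
proof -
  have "\<exists>s. power_series_sums v a x s" for x
  proof -
    define r where "r = v x + 1"
    have r: "r > 0"
      using v_nonneg[of x] by (simp add: r_def)
    then obtain C where C: "\<And>n. v (a $ n) * (2 * r) ^ n \<le> C"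
      using assms[of "2 * r"] by auto
    have "(\<lambda>n. v (a $ n * x ^ n)) \<longlonglongrightarrow> 0"
    proof (rule tendsto_sandwich[OF _ _ tendsto_const])
      show "\<forall>\<^sub>F n in sequentially. v (a $ n * x ^ n) \<le> C * (1 / 2) ^ n"
      proof (intro always_eventually allI)
        fix n
        have "v (a $ n * x ^ n) \<le> v (a $ n) * r ^ n"
          unfolding v_mult v_power by (intro mult_left_mono power_mono v_nonneg) (auto simp: r_def)
        also have "\<dots> = v (a $ n) * (2 * r) ^ n * (1 / 2) ^ n"
          by (simp add: power_mult_distrib field_simps)
        also have "\<dots> \<le> C * (1 / 2) ^ n"
          by (intro mult_right_mono C) auto
        finally show "v (a $ n * x ^ n) \<le> C * (1 / 2) ^ n" .
      qed
      show "(\<lambda>n. C * (1 / 2) ^ n) \<longlonglongrightarrow> 0"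
        by (intro tendsto_mult_right_zero LIMSEQ_realpow_zero) auto
    qed (simp add: v_nonneg)
    then show ?thesis
      unfolding power_series_sums_def by (intro v_seq_convergent) simp
  qed
  then show ?thesis
    unfolding entire_functions_def by blast
qed

lemma entire_0 [simp]: "0 \<in> \<A>" and entire_const [simp]: "fps_const c \<in> \<A>"
  and entire_X [simp]: "fps_X \<in> \<A>"
proof -
  show c: "fps_const c \<in> \<A>" for c
    by (rule entireI, rule exI[of _ "v c"]) (auto simp: v_nonneg)
  show "0 \<in> \<A>"
    using c[of 0] by simp
  show "fps_X \<in> \<A>"
  proof (rule entireI)
    fix r :: real assume "r > 0"
    then show "\<exists>C. \<forall>n. v (fps_X $ n) * r ^ n \<le> C"
      by (intro exI[of _ r]) auto
  qed
qed

lemma entire_1 [simp]: "1 \<in> \<A>"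
  using entire_const[of 1] by simp

lemma entire_uminus [simp]: "a \<in> \<A> \<Longrightarrow> - a \<in> \<A>"
  by (rule entireI) (metis entire_bounded fps_neg_nth v_minus)

lemma entire_add [simp]:
  assumes "a \<in> \<A>" "b \<in> \<A>"
  shows "a + b \<in> \<A>"
proof (rule entireI)
  fix r :: real assume r: "r > 0"
  obtain C where C: "\<And>n. v (a $ n) * r ^ n \<le> C"
    using entire_bounded[OF assms(1) r] by metis
  obtain D where D: "\<And>n. v (b $ n) * r ^ n \<le> D"
    using entire_bounded[OF assms(2) r] by metis
  have "v ((a + b) $ n) * r ^ n \<le> max C D" for n
  proof -
    have "v ((a + b) $ n) * r ^ n \<le> max (v (a $ n)) (v (b $ n)) * r ^ n"
      using r by (intro mult_right_mono) (auto intro: v_ultrametric)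
    also have "\<dots> \<le> max C D"
      using C[of n] D[of n] by (auto simp: max_def)
    finally show ?thesis .
  qed
  then show "\<exists>C. \<forall>n. v ((a + b) $ n) * r ^ n \<le> C"
    by blast
qed

lemma entire_diff [simp]: "a \<in> \<A> \<Longrightarrow> b \<in> \<A> \<Longrightarrow> a - b \<in> \<A>"
  using entire_add[of a "- b"] by simp

lemma entire_mult [simp]:
  assumes "a \<in> \<A>" "b \<in> \<A>"
  shows "a * b \<in> \<A>"
proof (rule entireI)
  fix r :: real assume r: "r > 0"
  obtain C where C: "\<And>n. v (a $ n) * r ^ n \<le> C" "C \<ge> 0"
    using entire_bounded[OF assms(1) r] by metis
  obtain D where D: "\<And>n. v (b $ n) * r ^ n \<le> D" "D \<ge> 0"
    using entire_bounded[OF assms(2) r] by metis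
  have "v ((a * b) $ n) * r ^ n \<le> C * D" for n
  proof -
    have "v ((a * b) $ n) \<le> C * D / r ^ n"
      unfolding fps_mult_nth
    proof (rule v_sum_le)
      fix i assume "i \<in> {0..n}"
      then have "r ^ n = r ^ i * r ^ (n - i)"
        by (simp flip: power_add)
      then have "v (a $ i * b $ (n - i)) * r ^ n = (v (a $ i) * r ^ i) * (v (b $ (n - i)) * r ^ (n - i))"
        by (simp add: v_mult)
      also have "\<dots> \<le> C * D"
        using C D r by (intro mult_mono) (auto simp: v_nonneg)
      finally show "v (a $ i * b $ (n - i)) \<le> C * D / r ^ n"
        using r by (simp add: field_simps)
    qed (use C D r in auto)
    then show ?thesis
      using r by (simp add: field_simps)
  qed
  then show "\<exists>C. \<forall>n. v ((a * b) $ n) * r ^ n \<le> C"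
    by blast
qed

lemma entire_power [simp]: "a \<in> \<A> \<Longrightarrow> a ^ n \<in> \<A>"
  by (induction n) auto

lemma entire_prod: "(\<And>x. x \<in> S \<Longrightarrow> f x \<in> \<A>) \<Longrightarrow> prod f S \<in> \<A>"
  by (induction S rule: infinite_finite_induct) auto

lemma entire_prod_list: "(\<And>x. x \<in> set xs \<Longrightarrow> x \<in> \<A>) \<Longrightarrow> prod_list xs \<in> \<A>"
  by (induction xs) auto

lemma v_fps_deriv_nth_le:
  assumes "r > 0"
  shows "v (fps_deriv a $ n) * r ^ n \<le> v (a $ Suc n) * r ^ Suc n / r"
proof -
  have "v (fps_deriv a $ n) * r ^ n = v (of_nat (Suc n)) * (v (a $ Suc n) * r ^ n)"
    by (simp add: v_mult)
  also have "\<dots> \<le> 1 * (v (a $ Suc n) * r ^ n)"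
    using assms by (intro mult_right_mono v_of_nat_le) (simp add: v_nonneg)
  finally show ?thesis
    using assms by simp
qed

lemma entire_deriv [simp]:
  assumes "a \<in> \<A>"
  shows "fps_deriv a \<in> \<A>"
proof (rule entireI)
  fix r :: real assume r: "r > 0"
  obtain C where C: "\<And>n. v (a $ n) * r ^ n \<le> C" "C \<ge> 0"
    using entire_bounded[OF assms(1) r] by metis
  have "v (fps_deriv a $ n) * r ^ n \<le> C / r" for n
    using v_fps_deriv_nth_le[OF r, of a n] C(1)[of "Suc n"] r
    by (meson divide_right_mono less_imp_le order_trans)
  then show "\<exists>C. \<forall>n. v (fps_deriv a $ n) * r ^ n \<le> C"
    by blast
qed

section \<open>Gauss norms\<close>

definition gauss_norm :: "real \<Rightarrow> 'k fps \<Rightarrow> real" where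
  "gauss_norm r a = (SUP n. v (a $ n) * r ^ n)"

text \<open>The last index at which the largest term is attained. Strictness beyond \<open>n\<close>
  makes it unique and, for \<open>r > 0\<close>, forces the largest term to be positive. It bounds
  the number of zeros in the closed disc of radius \<open>r\<close>, counted with
  multiplicity.\<close>

definition dominant_index :: "real \<Rightarrow> 'k fps \<Rightarrow> nat \<Rightarrow> bool" where
  "dominant_index r a n \<longleftrightarrow>
    (\<forall>i. v (a $ i) * r ^ i \<le> v (a $ n) * r ^ n) \<and> (\<forall>i>n. v (a $ i) * r ^ i < v (a $ n) * r ^ n)"

lemma dominant_indexD:
  assumes "dominant_index r a n"
  shows "v (a $ i) * r ^ i \<le> v (a $ n) * r ^ n"
    and "i > n \<Longrightarrow> v (a $ i) * r ^ i < v (a $ n) * r ^ n"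
  using assms by (auto simp: dominant_index_def)

lemma dominant_index_pos:
  assumes "dominant_index r a n" "r > 0"
  shows "0 < v (a $ n) * r ^ n"
proof -
  have "0 \<le> v (a $ Suc n) * r ^ Suc n"
    using assms(2) by (simp add: v_nonneg)
  also have "\<dots> < v (a $ n) * r ^ n"
    using assms(1) by (rule dominant_indexD) simp
  finally show ?thesis .
qed

lemma dominant_index_unique: "dominant_index r a n \<Longrightarrow> dominant_index r a m \<Longrightarrow> n = m"
  unfolding dominant_index_def by (metis linorder_neqE_nat not_le)

lemma gauss_norm_dominant: "dominant_index r a n \<Longrightarrow> gauss_norm r a = v (a $ n) * r ^ n"
  unfolding gauss_norm_def by (intro cSup_eq_maximum) (auto simp: dominant_index_def)

text \<open>Only finitely many terms are as large as a chosen nonzero one, so the maximum is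
  attained, and there is a last index attaining it.\<close>

lemma dominant_index_exists:
  assumes "a \<in> \<A>" "r > 0" "a \<noteq> 0"
  obtains n where "dominant_index r a n"
proof -
  define w where "w n = v (a $ n) * r ^ n" for n
  obtain j where "a $ j \<noteq> 0"
    using assms(3) by (auto simp: fps_eq_iff)
  then have j: "w j > 0"
    using assms(2) v_pos by (simp add: w_def)
  have "w \<longlonglongrightarrow> 0"
    unfolding w_def by (rule v_coeff_tendsto_0) fact+
  then have "eventually (\<lambda>n. w n < w j) sequentially"
    using j order_tendstoD(2) by blast
  then obtain M where M: "\<And>n. n \<ge> M \<Longrightarrow> w n < w j"
    by (auto simp: eventually_sequentially)
  define I where "I = {n. w j \<le> w n}"
  have fin: "finite I"
    by (rule finite_subset[of _ "{..<M}"]) (use M in \<open>auto simp: I_def not_less [symmetric]\<close>)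
  define m where "m = Max (w ` I)"
  have m: "m \<in> w ` I" "\<And>i. i \<in> I \<Longrightarrow> w i \<le> m"
    unfolding m_def using fin by (auto simp: I_def intro!: Max_in)
  have le: "w i \<le> m" for i
    using m(2)[of i] m(2)[of j] by (cases "i \<in> I") (auto simp: I_def)
  define n where "n = Max {i \<in> I. w i = m}"
  have n: "n \<in> {i \<in> I. w i = m}" "\<And>i. i \<in> {i \<in> I. w i = m} \<Longrightarrow> i \<le> n"
    unfolding n_def using fin m(1) by (intro Max_in Max_ge; force)+
  have "w i < m" if "i > n" for i
    using n(2)[of i] n(1) le[of i] that by (auto simp: I_def le_less)
  then have "dominant_index r a n"
    using le n(1) by (auto simp: dominant_index_def w_def)
  then show ?thesis
    using that by blast
qed

text \<open>Gauss's lemma. In the coefficient of index \<open>n + m\<close>, every product other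
  than \<open>a $ n * b $ m\<close> involves an index beyond a dominant one and is strictly smaller,
  so the isosceles principle gives the exact absolute value.\<close>

lemma dominant_index_mult:
  assumes a: "dominant_index r a n" and b: "dominant_index r b m" and r: "r > 0"
  shows "v ((a * b) $ (n + m)) = v (a $ n) * v (b $ m)"
    and "dominant_index r (a * b) (n + m)"
proof -
  define A where "A = v (a $ n) * r ^ n"
  define B where "B = v (b $ m) * r ^ m"
  have A: "A > 0" and B: "B > 0"
    unfolding A_def B_def using assms by (auto intro: dominant_index_pos)
  have split: "v (a $ i * b $ (l - i)) * r ^ l = (v (a $ i) * r ^ i) * (v (b $ (l - i)) * r ^ (l - i))"
    if "i \<le> l" for i l
    using that by (simp add: v_mult mult_ac flip: power_add)
  have le: "v (a $ i * b $ (l - i)) \<le> A * B / r ^ l" if "i \<le> l" for i l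
  proof -
    have "(v (a $ i) * r ^ i) * (v (b $ (l - i)) * r ^ (l - i)) \<le> A * B"
      using r A dominant_indexD(1)[OF a] dominant_indexD(1)[OF b]
      by (intro mult_mono) (auto simp: A_def B_def v_nonneg)
    then show ?thesis
      using split[OF that] r by (simp add: pos_le_divide_eq)
  qed
  have less: "v (a $ i * b $ (l - i)) < A * B / r ^ l" if "i \<le> l" "i > n \<or> l - i > m" for i l
  proof -
    have "(v (a $ i) * r ^ i) * (v (b $ (l - i)) * r ^ (l - i)) < A * B"
      using that(2)
    proof
      assume "i > n"
      have "(v (a $ i) * r ^ i) * (v (b $ (l - i)) * r ^ (l - i)) \<le> (v (a $ i) * r ^ i) * B"
        using r dominant_indexD(1)[OF b] by (intro mult_left_mono) (auto simp: B_def v_nonneg)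
      also have "\<dots> < A * B"
        using \<open>i > n\<close> B dominant_indexD(2)[OF a] by (simp add: A_def)
      finally show ?thesis .
    next
      assume "l - i > m"
      have "(v (a $ i) * r ^ i) * (v (b $ (l - i)) * r ^ (l - i)) \<le> A * (v (b $ (l - i)) * r ^ (l - i))"
        using r dominant_indexD(1)[OF a] by (intro mult_right_mono) (auto simp: A_def v_nonneg)
      also have "\<dots> < A * B"
        using \<open>l - i > m\<close> A dominant_indexD(2)[OF b] by (simp add: B_def)
      finally show ?thesis .
    qed
    then show ?thesis
      using split[OF that(1)] r by (simp add: field_simps)
  qed
  have "v (a $ n * b $ m) = A * B / r ^ (n + m)"
    using r by (simp add: v_mult A_def B_def power_add)
  moreover have "(a * b) $ (n + m) = (\<Sum>i\<in>{0..n+m} - {n}. a $ i * b $ (n + m - i)) + a $ n * b $ m"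
    unfolding fps_mult_nth by (subst sum.remove[of _ n]) auto
  moreover have "v (\<Sum>i\<in>{0..n+m} - {n}. a $ i * b $ (n + m - i)) < A * B / r ^ (n + m)"
    using A B r by (intro v_sum_less less) auto
  ultimately have eq: "v ((a * b) $ (n + m)) = A * B / r ^ (n + m)"
    by (metis v_add_eq)
  then show "v ((a * b) $ (n + m)) = v (a $ n) * v (b $ m)"
    using r by (simp add: A_def B_def power_add)
  have "v ((a * b) $ i) * r ^ i \<le> A * B" for i
  proof -
    have "v ((a * b) $ i) \<le> A * B / r ^ i"
      unfolding fps_mult_nth using A B r by (intro v_sum_le le) auto
    then show ?thesis
      using r by (simp add: field_simps)
  qed
  moreover have "v ((a * b) $ i) * r ^ i < A * B" if "i > n + m" for i
  proof -
    have "v ((a * b) $ i) < A * B / r ^ i"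
      unfolding fps_mult_nth using A B r that by (intro v_sum_less less) auto
    then show ?thesis
      using r by (simp add: field_simps)
  qed
  ultimately show "dominant_index r (a * b) (n + m)"
    using eq r by (simp add: dominant_index_def)
qed

lemma gauss_norm_0 [simp]: "gauss_norm r 0 = 0"
  by (simp add: gauss_norm_def)

lemma gauss_norm_const [simp]:
  assumes "r > 0"
  shows "gauss_norm r (fps_const c) = v c"
proof (cases "c = 0")
  case False
  then have "dominant_index r (fps_const c) 0"
    by (auto simp: dominant_index_def v_pos v_nonneg)
  then show ?thesis
    by (simp add: gauss_norm_dominant)
qed simp

lemma v_nth_le_gauss_norm:
  assumes "a \<in> \<A>" "r > 0"
  shows "v (a $ n) * r ^ n \<le> gauss_norm r a"
proof (cases "a = 0")
  case False
  then obtain m where "dominant_index r a m"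
    using dominant_index_exists assms by blast
  then show ?thesis
    by (simp add: gauss_norm_dominant dominant_indexD)
qed simp

lemma gauss_norm_leI: "(\<And>n. v (a $ n) * r ^ n \<le> B) \<Longrightarrow> gauss_norm r a \<le> B"
  unfolding gauss_norm_def by (intro cSUP_least) auto

lemma gauss_norm_nonneg:
  assumes "a \<in> \<A>" "r > 0"
  shows "0 \<le> gauss_norm r a"
  using v_nth_le_gauss_norm[OF assms, of 0] v_nonneg[of "a $ 0"] by simp

lemma gauss_norm_mult:
  assumes "a \<in> \<A>" "b \<in> \<A>" "r > 0"
  shows "gauss_norm r (a * b) = gauss_norm r a * gauss_norm r b"
proof (cases "a = 0 \<or> b = 0")
  case False
  then obtain n m where nm: "dominant_index r a n" "dominant_index r b m"
    using dominant_index_exists assms by metis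
  then show ?thesis
    using dominant_index_mult[OF nm assms(3)]
    by (simp add: gauss_norm_dominant power_add)
qed auto

lemma gauss_norm_prod:
  assumes "\<And>x. x \<in> S \<Longrightarrow> f x \<in> \<A>" "r > 0"
  shows "gauss_norm r (prod f S) = (\<Prod>x\<in>S. gauss_norm r (f x))"
  using assms(1)
proof (induction S rule: infinite_finite_induct)
  case (insert x F)
  then show ?case
    using assms(2) entire_prod[of F f] by (simp add: gauss_norm_mult)
qed (use gauss_norm_const[OF assms(2), of 1] in simp_all)

lemma gauss_norm_add_le:
  assumes "a \<in> \<A>" "b \<in> \<A>" "r > 0"
  shows "gauss_norm r (a + b) \<le> max (gauss_norm r a) (gauss_norm r b)"
proof (rule gauss_norm_leI)
  fix n
  have "v ((a + b) $ n) * r ^ n \<le> max (v (a $ n)) (v (b $ n)) * r ^ n"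
    using assms by (intro mult_right_mono) (auto intro: v_ultrametric)
  also have "\<dots> = max (v (a $ n) * r ^ n) (v (b $ n) * r ^ n)"
    using assms(3) by (simp add: max_mult_distrib_right)
  also have "\<dots> \<le> max (gauss_norm r a) (gauss_norm r b)"
    using assms v_nth_le_gauss_norm by (intro max.mono) auto
  finally show "v ((a + b) $ n) * r ^ n \<le> max (gauss_norm r a) (gauss_norm r b)" .
qed

lemma gauss_norm_uminus [simp]: "gauss_norm r (- a) = gauss_norm r a"
  by (simp add: gauss_norm_def)

lemma gauss_norm_add_eq:
  assumes "a \<in> \<A>" "b \<in> \<A>" "r > 0" "gauss_norm r a < gauss_norm r b"
  shows "gauss_norm r (a + b) = gauss_norm r b"
  using gauss_norm_add_le[OF assms(1-3)] gauss_norm_add_le[of "a + b" "- a" r] assms by simp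

lemma gauss_norm_deriv_le:
  assumes "a \<in> \<A>" "r > 0"
  shows "gauss_norm r (fps_deriv a) \<le> gauss_norm r a / r"
proof (rule gauss_norm_leI)
  fix n
  show "v (fps_deriv a $ n) * r ^ n \<le> gauss_norm r a / r"
    using v_fps_deriv_nth_le[OF assms(2), of a n] v_nth_le_gauss_norm[OF assms, of "Suc n"] assms(2)
    by (meson divide_right_mono less_imp_le order_trans)
qed


section \<open>Values, linear factors and zeros\<close>

lemma entire_X_minus [simp]: "fps_X - fps_const x \<in> \<A>"
  by simp

lemma nth_X_minus_mult:
  fixes h :: "'k fps"
  shows
  "((fps_X - fps_const x) * h) $ n = (case n of 0 \<Rightarrow> 0 | Suc m \<Rightarrow> h $ m) - x * h $ n"
  by (cases n) (simp_all only: left_diff_distrib fps_sub_nth fps_X_mult_nth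
    fps_mult_left_const_nth, simp_all)

text \<open>Evaluated at \<open>x\<close>, the terms of \<open>(fps_X - fps_const x) * h\<close>
  telescope and leave a single boundary term.\<close>

lemma partial_sum_linear_factor:
  fixes a :: "'k fps"
  assumes "a = fps_const s + (fps_X - fps_const x) * h"
  shows "(\<Sum>i<Suc n. a $ i * x ^ i) = s - h $ n * x ^ Suc n"
proof (induction n)
  case (Suc n)
  have "a $ Suc n = h $ n - x * h $ Suc n"
    unfolding assms by (simp add: nth_X_minus_mult)
  have "(h $ n - x * h $ Suc n) * x ^ Suc n = h $ n * x ^ Suc n - h $ Suc n * x ^ Suc (Suc n)"
    by (simp add: algebra_simps)
  then show ?case
    using Suc \<open>a $ Suc n = h $ n - x * h $ Suc n\<close> by (simp del: power_Suc)
qed (simp add: assms nth_X_minus_mult mult.commute)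

lemma power_series_sums_linear_factor:
  assumes "h \<in> \<A>" "a = fps_const s + (fps_X - fps_const x) * h"
  shows "power_series_sums v a x s"
proof -
  have "(\<lambda>n. v (h $ n) * v x ^ n * v x) \<longlonglongrightarrow> 0"
  proof (cases "x = 0")
    case False
    then show ?thesis
      by (intro tendsto_mult_left_zero v_coeff_tendsto_0 assms v_pos)
  qed simp
  moreover have "v ((\<Sum>i<Suc n. a $ i * x ^ i) - s) = v (h $ n) * v x ^ n * v x" for n
    unfolding partial_sum_linear_factor[OF assms(2)] by (simp add: v_mult v_power mult_ac)
  ultimately have "(\<lambda>n. v ((\<Sum>i<Suc n. a $ i * x ^ i) - s)) \<longlonglongrightarrow> 0"
    by (simp only:)
  then show ?thesis
    unfolding power_series_sums_def by (rule LIMSEQ_imp_Suc)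
qed

lemma v_tail_le:
  assumes "power_series_sums v a x s" "0 \<le> B"
    and "\<And>j. j \<ge> n \<Longrightarrow> v (a $ j * x ^ j) \<le> B"
  shows "v (s - (\<Sum>i<n. a $ i * x ^ i)) \<le> B"
proof -
  let ?S = "\<lambda>m. \<Sum>i<m. a $ i * x ^ i"
  have diff: "v (?S m - ?S n) \<le> B" if "m \<ge> n" for m
  proof -
    have "?S m = ?S n + (\<Sum>i\<in>{n..<m}. a $ i * x ^ i)"
      using sum.atLeastLessThan_concat[of 0 n m "\<lambda>i. a $ i * x ^ i"] that
      by (simp add: atLeast0LessThan)
    then show ?thesis
      using assms by (auto intro: v_sum_le)
  qed
  have le: "v (s - ?S n) \<le> v (?S m - s) + B" if "m \<ge> n" for m
    using v_diff_trans[of s "?S n" "?S m"] diff[OF that] v_nonneg[of "?S m - s"] assms(2)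
    unfolding v_minus_commute[of s "?S m"] by linarith
  have "(\<lambda>m. v (?S m - s) + B) \<longlonglongrightarrow> 0 + B"
    using assms(1) unfolding power_series_sums_def by (intro tendsto_intros)
  then show ?thesis
    using le by (intro LIMSEQ_le_const[where X = "\<lambda>m. v (?S m - s) + B"]) auto
qed

text \<open>The coefficients of the quotient are the tails \<open>s - S (Suc i)\<close> divided by
  \<open>x ^ Suc i\<close>; the tail estimate makes them decay fast enough for an entire function.
  At \<open>x = 0\<close> the division is an index shift.\<close>

lemma linear_factor_of_power_series_sums:
  assumes "a \<in> \<A>" "power_series_sums v a x s"
  obtains h where "h \<in> \<A>" "a = fps_const s + (fps_X - fps_const x) * h"
proof (cases "x = 0")
  case True
  have "power_series_sums v a x (a $ 0)"
    unfolding power_series_sums_def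
    by (rule tendsto_eventually) (auto simp: True eventually_sequentially
      lessThan_Suc_eq_insert_0 sum.reindex elim!: less_eqE intro!: exI[of _ 1])
  then have s: "s = a $ 0"
    using assms(2) unfolding power_series_sums_def by (intro v_limit_unique) auto
  show ?thesis
  proof
    show "fps_shift 1 a \<in> \<A>"
    proof (rule entireI)
      fix r :: real assume r: "r > 0"
      then obtain C where C: "\<And>n. v (a $ n) * r ^ n \<le> C"
        using entire_bounded[OF assms(1)] by metis
      have "v (fps_shift 1 a $ n) * r ^ n \<le> C / r" for n
        using C[of "Suc n"] r by (simp add: field_simps)
      then show "\<exists>C. \<forall>n. v (fps_shift 1 a $ n) * r ^ n \<le> C"
        by blast
    qed
    show "a = fps_const s + (fps_X - fps_const x) * fps_shift 1 a"
      by (simp add: fps_eq_iff nth_X_minus_mult True s split: nat.splits)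
  qed
next
  case False
  then have x: "v x > 0"
    by (rule v_pos)
  define S where "S n = (\<Sum>i<n. a $ i * x ^ i)" for n
  define h where "h = Abs_fps (\<lambda>i. (s - S (Suc i)) / x ^ Suc i)"
  show ?thesis
  proof
    show "a = fps_const s + (fps_X - fps_const x) * h"
    proof (rule fps_ext)
      fix n show "a $ n = (fps_const s + (fps_X - fps_const x) * h) $ n"
        using False by (cases n) (simp_all add: nth_X_minus_mult h_def S_def field_simps)
    qed
    show "h \<in> \<A>"
    proof (rule entireI)
      fix r :: real assume r: "r > 0"
      \<comment> \<open>\<open>R\<close> dominates both radii: \<open>v x / R\<close> is at most 1,
        so its powers decrease, and the bound obtained at \<open>R\<close> also holds at
        \<open>r\<close>.\<close>
      define R where "R = max r (v x)"
      have R: "R > 0" "r \<le> R" "v x \<le> R"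
        using r by (auto simp: R_def)
      then obtain C where C: "\<And>n. v (a $ n) * R ^ n \<le> C" "C \<ge> 0"
        using entire_bounded[OF assms(1)] by metis
      have "v (h $ i) * r ^ i \<le> C / R" for i
      proof -
        have "v (s - S (Suc i)) \<le> C * (v x / R) ^ Suc i"
          unfolding S_def
        proof (rule v_tail_le[OF assms(2)])
          fix j assume j: "j \<ge> Suc i"
          have "v (a $ j * x ^ j) = v (a $ j) * R ^ j * (v x / R) ^ j"
            using R by (simp add: v_mult v_power power_divide)
          also have "\<dots> \<le> C * (v x / R) ^ Suc i"
            using R x C j by (intro mult_mono power_decreasing) auto
          finally show "v (a $ j * x ^ j) \<le> C * (v x / R) ^ Suc i" .
        qed (use C R x in simp)
        then have "v (h $ i) \<le> C * (v x / R) ^ Suc i / v x ^ Suc i"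
          unfolding h_def using x by (simp add: v_divide v_power divide_right_mono del: power_Suc)
        also have "\<dots> = C / R ^ Suc i"
          using x R by (simp add: power_divide)
        finally have "v (h $ i) * r ^ i \<le> C / R ^ Suc i * R ^ i"
          using R r C by (intro mult_mono power_mono) auto
        then show ?thesis
          using R by simp
      qed
      then show "\<exists>C. \<forall>n. v (h $ n) * r ^ n \<le> C"
        by blast
    qed
  qed
qed

lemma entire_value_eqI:
  assumes "power_series_sums v a x s"
  shows "entire_value v a x = s"
  unfolding entire_value_def
  by (rule the_equality) (use assms v_limit_unique in \<open>auto simp: power_series_sums_def\<close>)

text \<open>Turns statements about values into ring identities modulo
  \<open>fps_X - fps_const x\<close>; multiplicativity of evaluation then follows without limits of
  products.\<close>

lemma entire_value_decomp:
  assumes "a \<in> \<A>"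
  obtains h where "h \<in> \<A>" "a = fps_const (entire_value v a x) + (fps_X - fps_const x) * h"
proof -
  obtain s where s: "power_series_sums v a x s"
    using assms unfolding entire_functions_def by blast
  then show ?thesis
    using linear_factor_of_power_series_sums[OF assms s] entire_value_eqI[OF s] that by metis
qed

lemma entire_value_1 [simp]: "entire_value v 1 x = 1"
  by (rule entire_value_eqI, rule power_series_sums_linear_factor[of 0]) auto

lemma entire_value_mult:
  assumes "a \<in> \<A>" "b \<in> \<A>"
  shows "entire_value v (a * b) x = entire_value v a x * entire_value v b x"
proof -
  define s t where "s = entire_value v a x" and "t = entire_value v b x"
  obtain h where h: "h \<in> \<A>" "a = fps_const s + (fps_X - fps_const x) * h"
    unfolding s_def using entire_value_decomp[OF assms(1)] by metis
  obtain k where k: "k \<in> \<A>" "b = fps_const t + (fps_X - fps_const x) * k"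
    unfolding t_def using entire_value_decomp[OF assms(2)] by metis
  have "a * b = fps_const (s * t) + (fps_X - fps_const x) * (fps_const s * k + h * b)"
    unfolding fps_const_mult[symmetric] using h(2) k(2) by algebra
  then show ?thesis
    using h(1) k(1) assms(2) unfolding s_def t_def
    by (intro entire_value_eqI power_series_sums_linear_factor[of "fps_const s * k + h * b"])
      (auto simp: s_def)
qed

lemma entire_value_linear_factor:
  assumes "h \<in> \<A>"
  shows "entire_value v ((fps_X - fps_const x) * h) x = 0"
  by (rule entire_value_eqI, rule power_series_sums_linear_factor[OF assms]) simp

lemma entire_linear_factor_iff:
  assumes "a \<in> \<A>"
  shows "entire_value v a x = 0 \<longleftrightarrow> (\<exists>h\<in>\<A>. a = (fps_X - fps_const x) * h)"
proof
  assume "entire_value v a x = 0"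
  then show "\<exists>h\<in>\<A>. a = (fps_X - fps_const x) * h"
    using entire_value_decomp[OF assms, of x] by (metis add_0 fps_const_0_eq_0)
qed (auto simp: entire_value_linear_factor)

section \<open>Small roots of polynomials and existence of zeros\<close>

text \<open>Induction on the degree: splitting off a root \<open>x\<close> multiplies the absolute
  value of the constant coefficient by \<open>v x\<close>, and since \<open>d \<le> v x\<close> it
  enlarges the bound on the weighted coefficients by no more than that.\<close>

lemma poly_root_small:
  fixes p :: "'k poly"
  assumes "0 \<le> d" "\<And>z. poly p z = 0 \<Longrightarrow> d \<le> v z"
  shows "v (coeff p j) * d ^ j \<le> v (coeff p 0)"
  using assms(2)
proof (induction "degree p" arbitrary: p j)
  case 0
  then show ?case
    by (cases j) (auto simp: coeff_eq_0 v_nonneg)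
next
  case (Suc n)
  then obtain x where x: "poly p x = 0"
    using alg_closed_imp_poly_has_root[of p] by auto
  then obtain q where q: "p = [:- x, 1:] * q"
    by (auto simp: poly_eq_0_iff_dvd)
  have "q \<noteq> 0"
    using Suc(2) q by auto
  then have "degree q = n"
    using Suc(2) unfolding q by (subst (asm) degree_mult_eq) auto
  then have IH: "v (coeff q j) * d ^ j \<le> v (coeff q 0)" for j
    using Suc q by auto
  have dx: "d \<le> v x"
    using Suc x by blast
  show ?case
  proof (cases j)
    case (Suc i)
    have "coeff p j = coeff q i - x * coeff q j"
      by (simp add: q Suc)
    then have "v (coeff p j) * d ^ j \<le> max (v (coeff q i)) (v (x * coeff q j)) * d ^ j"
      using assms(1) by (auto intro!: mult_right_mono v_diff)
    also have "\<dots> = max (v (coeff q i) * d ^ i * d) (v x * (v (coeff q j) * d ^ j))"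
      using assms(1) by (subst max_mult_distrib_right) (simp add: Suc v_mult mult_ac)
    also have "\<dots> \<le> v x * v (coeff q 0)"
      using IH[of i] IH[of j] dx assms(1)
      by (auto intro!: mult_left_mono mult_mono simp: v_nonneg mult.commute[of "v x"])
    also have "\<dots> = v (coeff p 0)"
      by (simp add: q v_mult)
    finally show ?thesis .
  qed simp
qed

text \<open>The preceding bound with \<open>d\<close> the least absolute value of a root; the
  nonzero coefficient at \<open>j > 0\<close> ensures that a root exists.\<close>

lemma poly_root_near:
  fixes p :: "'k poly"
  assumes "coeff p j \<noteq> 0" "j > 0"
  obtains z where "poly p z = 0" "v (coeff p j) * v z ^ j \<le> v (coeff p 0)"
proof -
  have "p \<noteq> 0"
    using assms by auto
  have "degree p > 0"
    using le_degree[OF assms(1)] assms(2) by simp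
  define Z where "Z = {z. poly p z = 0}"
  have Z: "finite Z" "Z \<noteq> {}"
    unfolding Z_def using poly_roots_finite[OF \<open>p \<noteq> 0\<close>]
      alg_closed_imp_poly_has_root[OF \<open>degree p > 0\<close>] by auto
  define d where "d = Min (v ` Z)"
  have "d \<in> v ` Z"
    unfolding d_def using Z by (intro Min_in) auto
  then obtain z where z: "z \<in> Z" "d = v z"
    by blast
  have "v (coeff p j) * d ^ j \<le> v (coeff p 0)"
  proof (rule poly_root_small)
    show "d \<le> v y" if "poly p y = 0" for y
      unfolding d_def using Z that by (intro Min_le) (auto simp: Z_def)
  qed (simp add: z v_nonneg)
  then show ?thesis
    using z that by (auto simp: Z_def)
qed

lemma pcompose_monom: "pcompose (monom c i) q = smult c (q ^ i)" for c :: 'k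
proof (induction i)
  case (Suc i)
  then show ?case
    by (simp add: monom_Suc pcompose_pCons)
qed (simp add: monom_0)

text \<open>Taylor expansion at \<open>b\<close>: the shifted polynomial has constant coefficient
  \<open>poly p b\<close>, and its roots are the differences \<open>z - b\<close>. A small value at
  \<open>b\<close> thus forces a root near \<open>b\<close>.\<close>

lemma shifted_root_near:
  fixes p :: "'k poly"
  assumes "coeff (pcompose p [:b, 1:]) j \<noteq> 0" "j > 0"
  obtains z where "poly p z = 0" "v (coeff (pcompose p [:b, 1:]) j) * v (z - b) ^ j \<le> v (poly p b)"
proof -
  obtain y where "poly (pcompose p [:b, 1:]) y = 0"
    "v (coeff (pcompose p [:b, 1:]) j) * v y ^ j \<le> v (coeff (pcompose p [:b, 1:]) 0)"
    using poly_root_near[OF assms] .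
  then show ?thesis
    using that[of "b + y"] by (simp add: poly_pcompose pcompose_coeff_0)
qed

definition fps_trunc :: "nat \<Rightarrow> 'k fps \<Rightarrow> 'k poly" where
  "fps_trunc n a = (\<Sum>i<n. monom (a $ i) i)"

lemma poly_fps_trunc: "poly (fps_trunc n a) x = (\<Sum>i<n. a $ i * x ^ i)"
  by (simp add: fps_trunc_def poly_sum poly_monom)

text \<open>The \<open>N\<close>-th Taylor coefficient at \<open>b\<close> is the sum over
  \<open>i \<ge> N\<close> of \<open>a $ i\<close> times \<open>i choose N\<close> times
  \<open>b ^ (i - N)\<close>. The term \<open>i = N\<close> gives \<open>a $ N\<close>; the later
  ones are strictly smaller because \<open>N\<close> is dominant and
  \<open>v b \<le> r\<close>.\<close>

lemma v_coeff_shift_dominant: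
  assumes dom: "dominant_index r a N" and r: "r > 0" and "N < n" "v b \<le> r"
  shows "v (coeff (pcompose (fps_trunc n a) [:b, 1:]) N) = v (a $ N)"
proof -
  have N: "v (a $ N) > 0"
    using dominant_index_pos[OF dom r] r by (simp add: zero_less_mult_iff)
  let ?f = "\<lambda>i. a $ i * coeff ([:b, 1:] ^ i) N"
  have "coeff (pcompose (fps_trunc n a) [:b, 1:]) N = (\<Sum>i<n. ?f i)"
    by (simp add: fps_trunc_def pcompose_sum pcompose_monom coeff_sum)
  also have "\<dots> = (\<Sum>i\<in>{..<n} - {N}. ?f i) + ?f N"
    using assms(3) by (subst sum.remove[of _ N]) auto
  also have "v \<dots> = v (?f N)"
  proof (rule v_add_eq, rule v_sum_less)
    fix i assume i: "i \<in> {..<n} - {N}"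
    show "v (?f i) < v (?f N)"
    proof (cases "i < N")
      case True
      then have "degree ([:b, 1:] ^ i) < N"
        by (simp add: degree_linear_power)
      then show ?thesis
        using N by (simp add: coeff_eq_0 coeff_linear_power)
    next
      case False
      then have iN: "i > N"
        using i by auto
      have "v (?f i) = v (a $ i) * (v (of_nat (i choose N)) * v b ^ (i - N))"
        using iN by (simp add: coeff_linear_poly_power v_mult v_power)
      also have "\<dots> \<le> v (a $ i) * (1 * r ^ (i - N))"
        using assms(4) by (intro mult_left_mono mult_mono v_of_nat_le power_mono) (auto simp: v_nonneg)
      also have "\<dots> < v (a $ N)"
      proof -
        have "v (a $ i) * r ^ (i - N) * r ^ N = v (a $ i) * r ^ i"
          using iN by (simp add: mult.assoc flip: power_add)
        also have "\<dots> < v (a $ N) * r ^ N"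
          using dom iN by (rule dominant_indexD)
        finally show ?thesis
          using r by simp
      qed
      finally show ?thesis
        by (simp add: coeff_linear_power)
    qed
  qed (use N in \<open>simp add: coeff_linear_power\<close>)
  finally show ?thesis
    by (simp add: coeff_linear_power)
qed

text \<open>A Lipschitz bound on the disc of radius \<open>r\<close> that is uniform in
  \<open>n\<close>, so that a limit of zeros of the partial sums becomes a zero of the
  series.\<close>

lemma v_partial_sum_diff_le:
  assumes "\<And>n. v (a $ n) * r ^ n \<le> C" "r > 0" "v x \<le> r" "v y \<le> r"
  shows "v ((\<Sum>i<n. a $ i * x ^ i) - (\<Sum>i<n. a $ i * y ^ i)) \<le> C / r * v (x - y)"
proof -
  \<comment> \<open>The factor \<open>r\<close> is kept on the left so that the exponent on the
    right is \<open>i\<close> rather than \<open>i - 1\<close>, which also covers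
    \<open>i = 0\<close>.\<close>
  have pw: "v (x ^ i - y ^ i) * r \<le> r ^ i * v (x - y)" for i
  proof (induction i)
    case (Suc i)
    have "v (x ^ Suc i - y ^ Suc i) = v (x * (x ^ i - y ^ i) + y ^ i * (x - y))"
      by (simp add: algebra_simps)
    also have "\<dots> \<le> max (v x * v (x ^ i - y ^ i)) (v y ^ i * v (x - y))"
      using v_ultrametric by (metis v_mult v_power)
    finally have "v (x ^ Suc i - y ^ Suc i) * r
        \<le> max (v x * v (x ^ i - y ^ i)) (v y ^ i * v (x - y)) * r"
      using assms(2) by (intro mult_right_mono) auto
    also have "\<dots> = max (v x * (v (x ^ i - y ^ i) * r)) (v y ^ i * v (x - y) * r)"
      using assms(2) by (subst max_mult_distrib_right) (simp add: mult_ac)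
    also have "\<dots> \<le> max (r * (r ^ i * v (x - y))) (r ^ i * v (x - y) * r)"
    proof (rule max.mono)
      show "v x * (v (x ^ i - y ^ i) * r) \<le> r * (r ^ i * v (x - y))"
        by (rule mult_mono) (use Suc assms in \<open>auto simp: v_nonneg\<close>)
      show "v y ^ i * v (x - y) * r \<le> r ^ i * v (x - y) * r"
        using assms by (intro mult_right_mono power_mono) (auto simp: v_nonneg)
    qed
    finally show ?case
      by (simp add: mult_ac)
  qed (use assms(2) in \<open>simp add: v_nonneg\<close>)
  have C: "C \<ge> 0"
    using assms(1)[of 0] v_nonneg[of "a $ 0"] by simp
  have "v (\<Sum>i<n. a $ i * (x ^ i - y ^ i)) \<le> C / r * v (x - y)"
  proof (rule v_sum_le)
    fix i
    have "v (a $ i * (x ^ i - y ^ i)) * r = v (a $ i) * (v (x ^ i - y ^ i) * r)"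
      by (simp add: v_mult)
    also have "\<dots> \<le> v (a $ i) * (r ^ i * v (x - y))"
      by (intro mult_left_mono pw v_nonneg)
    also have "\<dots> = v (a $ i) * r ^ i * v (x - y)"
      by simp
    also have "\<dots> \<le> C * v (x - y)"
      by (intro mult_right_mono assms v_nonneg)
    finally show "v (a $ i * (x ^ i - y ^ i)) \<le> C / r * v (x - y)"
      using assms(2) by (simp add: field_simps)
  qed (use C assms(2) in \<open>simp add: v_nonneg\<close>)
  then show ?thesis
    by (simp add: right_diff_distrib sum_subtractf)
qed

text \<open>The zero is the limit of zeros \<open>b n\<close> of the partial sums. In a disc where \<open>N > 0\<close> is the
  dominant index, the partial sums have \<open>N\<close>-th Taylor coefficient of constant absolute value
  throughout the disc, so a small value at \<open>b n\<close> forces a zero close to \<open>b n\<close>.\<close>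

lemma entire_has_zero:
  assumes a: "a \<in> \<A>" and "a \<notin> range fps_const"
  obtains x h where "h \<in> \<A>" "a = (fps_X - fps_const x) * h"
proof -
  obtain j where j: "j > 0" "a $ j \<noteq> 0"
  proof -
    have "a \<noteq> fps_const (a $ 0)"
      using assms(2) by blast
    then obtain n where "a $ n \<noteq> fps_const (a $ 0) $ n"
      by (auto simp: fps_eq_iff)
    then show ?thesis
      using that[of n] by (cases n) auto
  qed
  \<comment> \<open>The summand 1 gives \<open>r \<ge> 1\<close>, hence
    \<open>r \<le> r ^ j\<close>, so the term of index \<open>j\<close> exceeds the constant term;
    the dominant index \<open>N\<close> is then positive.\<close>
  define r where "r = v (a $ 0) / v (a $ j) + 1"
  have r: "r \<ge> 1"
    using v_nonneg[of "a $ 0"] v_nonneg[of "a $ j"] by (simp add: r_def)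
  then have "r ^ 1 \<le> r ^ j"
    using j by (intro power_increasing) auto
  moreover have "v (a $ 0) < r * v (a $ j)"
    using v_pos[OF j(2)] by (simp add: r_def field_simps)
  ultimately have aj: "v (a $ 0) < v (a $ j) * r ^ j"
    using v_pos[OF j(2)] by (smt (verit) mult.commute mult_left_mono power_one_right)
  have "a \<noteq> 0" "r > 0"
    using j r by auto
  then obtain N where N: "dominant_index r a N"
    using dominant_index_exists[OF a] by metis
  have aN: "v (a $ 0) < v (a $ N) * r ^ N"
    using aj dominant_indexD(1)[OF N, of j] by simp
  then have N0: "N > 0"
    by (cases N) auto
  have vN: "v (a $ N) > 0"
    using dominant_index_pos[OF N \<open>r > 0\<close>] \<open>r > 0\<close> by (simp add: zero_less_mult_iff)
  \<comment> \<open>Every \<open>F n\<close> contains the terms up to index \<open>N\<close>, so its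
    \<open>N\<close>-th Taylor coefficient is controlled from \<open>n = 0\<close> on.\<close>
  define F where "F n = fps_trunc (Suc (N + n)) a" for n
  have cN: "v (coeff (pcompose (F n) [:b, 1:]) N) = v (a $ N)" if "v b \<le> r" for n b
    unfolding F_def using that by (intro v_coeff_shift_dominant[OF N \<open>r > 0\<close>]) auto
  have cN0: "coeff (pcompose (F n) [:b, 1:]) N \<noteq> 0" if "v b \<le> r" for n b
    using cN[OF that, of n] vN by auto
  have F0: "poly (F n) 0 = a $ 0" for n
    by (simp add: F_def poly_fps_trunc lessThan_Suc_eq_insert_0 sum.reindex)
  have "\<exists>b. \<forall>n. (v (b n) \<le> r \<and> poly (F n) (b n) = 0) \<and>
      v (a $ N) * v (b (Suc n) - b n) ^ N \<le> v (a $ Suc (N + n)) * r ^ Suc (N + n)"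
  proof (rule dependent_nat_choice)
    obtain z where z: "poly (F 0) z = 0" "v (a $ N) * v z ^ N \<le> v (a $ 0)"
      using shifted_root_near[OF cN0[of 0 0] N0] cN[of 0 0] r by (auto simp: F0)
    then have "v (a $ N) * v z ^ N < v (a $ N) * r ^ N"
      using aN by linarith
    then have "v z < r"
      using vN r v_nonneg[of z] by (intro power_less_imp_less_base[of "v z" N]) auto
    then show "\<exists>z. v z \<le> r \<and> poly (F 0) z = 0"
      using z by (intro exI[of _ z]) simp
  next
    fix b n assume b: "v b \<le> r \<and> poly (F n) b = 0"
    obtain z where z: "poly (F (Suc n)) z = 0"
      "v (a $ N) * v (z - b) ^ N \<le> v (poly (F (Suc n)) b)"
      using shifted_root_near[OF cN0[of b "Suc n"] N0] cN[of b "Suc n"] b by auto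
    \<comment> \<open>Since \<open>b\<close> is a zero of \<open>F n\<close>, only the newly added
      term remains, and it bounds the distance to the next zero.\<close>
    have "poly (F (Suc n)) b = poly (F n) b + a $ Suc (N + n) * b ^ Suc (N + n)"
      by (simp add: F_def poly_fps_trunc)
    then have "v (poly (F (Suc n)) b) = v (a $ Suc (N + n)) * v b ^ Suc (N + n)"
      using b by (simp add: v_mult v_power)
    also have "\<dots> \<le> v (a $ Suc (N + n)) * r ^ Suc (N + n)"
      using b by (intro mult_left_mono power_mono v_nonneg) auto
    finally have 1: "v (a $ N) * v (z - b) ^ N \<le> v (a $ Suc (N + n)) * r ^ Suc (N + n)"
      using z by simp
    also have "\<dots> \<le> v (a $ N) * r ^ N"
      using N by (rule dominant_indexD)
    finally have "v (z - b) \<le> r"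
      using vN r N0 v_nonneg[of "z - b"] by (auto simp: power_mono_iff)
    then have "v z \<le> r"
      using v_ultrametric[of "z - b" b] conjunct1[OF b] by simp
    then show "\<exists>z. (v z \<le> r \<and> poly (F (Suc n)) z = 0) \<and>
        v (a $ N) * v (z - b) ^ N \<le> v (a $ Suc (N + n)) * r ^ Suc (N + n)"
      using z 1 by blast
  qed
  then obtain b where b: "\<And>n. v (b n) \<le> r" "\<And>n. poly (F n) (b n) = 0"
    "\<And>n. v (a $ N) * v (b (Suc n) - b n) ^ N \<le> v (a $ Suc (N + n)) * r ^ Suc (N + n)"
    by blast
  have "(\<lambda>n. v (a $ n) * r ^ n / v (a $ N)) \<longlonglongrightarrow> 0 / v (a $ N)"
    using vN by (intro tendsto_divide v_coeff_tendsto_0 a \<open>r > 0\<close> tendsto_const) auto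
  then have "(\<lambda>n. v (a $ (n + Suc N)) * r ^ (n + Suc N) / v (a $ N)) \<longlonglongrightarrow> 0"
    by (intro LIMSEQ_ignore_initial_segment[where k = "Suc N"]) simp
  then have "(\<lambda>n. v (a $ Suc (N + n)) * r ^ Suc (N + n) / v (a $ N)) \<longlonglongrightarrow> 0"
    by (simp add: add.commute)
  then have "(\<lambda>n. v (b (Suc n) - b n) ^ N) \<longlonglongrightarrow> 0"
    by (rule tendsto_sandwich[OF _ _ tendsto_const, rotated -1])
      (use b(3) vN in \<open>auto simp: v_nonneg field_simps\<close>)
  \<comment> \<open>The \<open>N\<close>-th root removes the exponent; consecutive zeros approach
    each other, and completeness yields a limit.\<close>
  then have "(\<lambda>n. root N (v (b (Suc n) - b n) ^ N)) \<longlonglongrightarrow> root N 0"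
    by (intro tendsto_real_root)
  then have "(\<lambda>n. v (b (Suc n) - b n)) \<longlonglongrightarrow> 0"
    using N0 by (simp add: real_root_power_cancel v_nonneg)
  then obtain x where x: "(\<lambda>n. v (b n - x)) \<longlonglongrightarrow> 0"
    using v_seq_convergent by blast
  have xr: "v x \<le> r"
  proof -
    obtain n where "v (b n - x) < r"
      using order_tendstoD(2)[OF x \<open>r > 0\<close>] by (auto simp: eventually_sequentially)
    then show ?thesis
      using b(1)[of n] v_diff[of "b n" "b n - x"] by simp
  qed
  obtain C where C: "\<And>n. v (a $ n) * r ^ n \<le> C"
    using entire_bounded[OF a \<open>r > 0\<close>] by metis
  have "(\<lambda>n. v (poly (F n) x)) \<longlonglongrightarrow> 0"
  proof (rule tendsto_sandwich[OF _ _ tendsto_const])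
    show "(\<lambda>n. C / r * v (b n - x)) \<longlonglongrightarrow> 0"
      by (intro tendsto_mult_right_zero x)
    show "\<forall>\<^sub>F n in sequentially. v (poly (F n) x) \<le> C / r * v (b n - x)"
    proof (intro always_eventually allI)
      fix n show "v (poly (F n) x) \<le> C / r * v (b n - x)"
        using v_partial_sum_diff_le[of a r C x "b n" "Suc (N + n)", OF C \<open>r > 0\<close> xr b(1)] b(2)[of n]
        unfolding F_def poly_fps_trunc by (simp add: v_minus_commute[of x])
    qed
  qed (simp add: v_nonneg)
  then have "(\<lambda>n. v (\<Sum>i<n + Suc N. a $ i * x ^ i)) \<longlonglongrightarrow> 0"
    unfolding F_def poly_fps_trunc by (simp add: add.commute)
  then have "power_series_sums v a x 0"
    unfolding power_series_sums_def
    by (intro LIMSEQ_offset[of "\<lambda>n. v ((\<Sum>i<n. a $ i * x ^ i) - 0)" "Suc N"]) simp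
  then show ?thesis
    using linear_factor_of_power_series_sums[OF a] that by (metis add_0 fps_const_0_eq_0)
qed

section \<open>Factorization and counting of zeros\<close>

text \<open>Zeros are extracted one at a time. Either \<open>m\<close> linear factors come out, or
  the cofactor becomes constant after at most \<open>m\<close> steps; the list records
  multiplicities.\<close>

lemma entire_factorization:
  assumes "a \<in> \<A>"
  obtains (zeros) xs h where "length xs = m" "h \<in> \<A>" "a = (\<Prod>x\<leftarrow>xs. fps_X - fps_const x) * h"
    | (poly) xs c where "length xs \<le> m" "a = (\<Prod>x\<leftarrow>xs. fps_X - fps_const x) * fps_const c"
proof -
  have "(\<exists>xs h. length xs = m \<and> h \<in> \<A> \<and> a = (\<Prod>x\<leftarrow>xs. fps_X - fps_const x) * h) \<or>
      (\<exists>xs c. length xs \<le> m \<and> a = (\<Prod>x\<leftarrow>xs. fps_X - fps_const x) * fps_const c)"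
  proof (induction m)
    case (Suc m)
    then consider xs h where "length xs = m" "h \<in> \<A>" "a = (\<Prod>x\<leftarrow>xs. fps_X - fps_const x) * h"
      | xs c where "length xs \<le> m" "a = (\<Prod>x\<leftarrow>xs. fps_X - fps_const x) * fps_const c"
      by blast
    then show ?case
    proof cases
      case (1 xs h)
      show ?thesis
      proof (cases "h \<in> range fps_const")
        case True
        then obtain c where "h = fps_const c"
          by blast
        then have "length xs \<le> Suc m \<and> a = (\<Prod>x\<leftarrow>xs. fps_X - fps_const x) * fps_const c"
          using 1 by simp
        then show ?thesis
          by blast
      next
        case False
        then obtain x k where k: "k \<in> \<A>" "h = (fps_X - fps_const x) * k"
          using entire_has_zero[OF 1(2)] by metis
        then have "length (x # xs) = Suc m \<and> k \<in> \<A> \<and>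
            a = (\<Prod>x\<leftarrow>x # xs. fps_X - fps_const x) * k"
          using 1 by simp
        then show ?thesis
          by blast
      qed
    next
      case (2 xs c)
      then have "length xs \<le> Suc m \<and> a = (\<Prod>x\<leftarrow>xs. fps_X - fps_const x) * fps_const c"
        by simp
      then show ?thesis
        by blast
    qed
  qed (use assms in auto)
  then show ?thesis
    using that by blast
qed

lemma dominant_index_linear:
  assumes "v x \<le> r" "r > 0"
  shows "dominant_index r (fps_X - fps_const x) 1"
  using assms by (auto simp: dominant_index_def fps_X_def v_nonneg)

lemma dominant_index_linear_prod:
  assumes "\<And>x. x \<in> set xs \<Longrightarrow> v x \<le> r" "r > 0"
  shows "dominant_index r (\<Prod>x\<leftarrow>xs. fps_X - fps_const x) (length xs)"
  using assms(1)
proof (induction xs)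
  case Nil
  show ?case
    using assms(2) by (auto simp: dominant_index_def)
next
  case (Cons x xs)
  then have "dominant_index r ((fps_X - fps_const x) * (\<Prod>x\<leftarrow>xs. fps_X - fps_const x)) (1 + length xs)"
    using assms(2) by (intro dominant_index_mult dominant_index_linear) auto
  then show ?case
    by simp
qed

text \<open>Each linear factor with its zero in the disc has dominant index 1, and dominant indices
  add under multiplication.\<close>

lemma length_le_dominant_index:
  assumes "dominant_index r a N" "r > 0" "\<And>x. x \<in> set xs \<Longrightarrow> v x \<le> r"
    and "h \<in> \<A>" "a = (\<Prod>x\<leftarrow>xs. fps_X - fps_const x) * h"
  shows "length xs \<le> N"
proof -
  have "a \<noteq> 0"
    using dominant_index_pos[OF assms(1,2)] by auto
  then obtain n where "dominant_index r h n"
    using dominant_index_exists[OF assms(4,2)] assms(5) by fastforce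
  then have "dominant_index r a (length xs + n)"
    unfolding assms(5) using assms(2,3) by (intro dominant_index_mult dominant_index_linear_prod)
  then show ?thesis
    using dominant_index_unique[OF assms(1)] by simp
qed

text \<open>Infinitely many zeros in a disc would let more than \<open>N\<close> distinct linear
  factors be split off, where \<open>N\<close> is the dominant index at a radius at least
  \<open>r\<close>.\<close>

lemma finite_zeros:
  assumes "a \<in> \<A>" "a \<noteq> 0"
  shows "finite {x. entire_value v a x = 0 \<and> v x \<le> r}"
proof (rule ccontr)
  assume inf: "infinite {x. entire_value v a x = 0 \<and> v x \<le> r}"
  define R where "R = max r 1"
  have R: "R > 0" "r \<le> R"
    by (auto simp: R_def)
  obtain N where N: "dominant_index R a N"
    using dominant_index_exists assms R by metis
  obtain A where A: "finite A" "card A = Suc N" "A \<subseteq> {x. entire_value v a x = 0 \<and> v x \<le> r}"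
    using inf by (meson infinite_arbitrarily_large)
  obtain xs where xs: "set xs = A" "distinct xs"
    using finite_distinct_list[OF A(1)] by blast
  have "\<exists>h\<in>\<A>. a = (\<Prod>x\<leftarrow>ys. fps_X - fps_const x) * h" if "distinct ys" "set ys \<subseteq> A" for ys
    using that
  proof (induction ys)
    case Nil
    show ?case
      using assms by auto
  next
    case (Cons y ys)
    then obtain h where h: "h \<in> \<A>" "a = (\<Prod>x\<leftarrow>ys. fps_X - fps_const x) * h"
      by auto
    \<comment> \<open>Factors at other points do not vanish at \<open>y\<close>, so the zero of
      \<open>a\<close> at \<open>y\<close> is inherited by the cofactor \<open>h\<close>.\<close>
    have ev: "entire_value v (\<Prod>x\<leftarrow>zs. fps_X - fps_const x) y \<noteq> 0" if "y \<notin> set zs" for zs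
      using that
    proof (induction zs)
      case (Cons z zs)
      have "entire_value v (fps_X - fps_const z) y = y - z"
        by (rule entire_value_eqI, rule power_series_sums_linear_factor[of 1])
          (simp_all flip: fps_const_sub)
      moreover have "(\<Prod>x\<leftarrow>zs. fps_X - fps_const x) \<in> \<A>"
        by (rule entire_prod_list) auto
      ultimately show ?case
        using Cons entire_value_mult[OF entire_X_minus, of "\<Prod>x\<leftarrow>zs. fps_X - fps_const x" z y]
        by simp
    qed auto
    have "(\<Prod>x\<leftarrow>ys. fps_X - fps_const x) \<in> \<A>"
      by (rule entire_prod_list) auto
    moreover have "entire_value v a y = 0"
      using Cons A by auto
    ultimately have "entire_value v h y = 0"
      using ev[of ys] Cons h by (simp add: entire_value_mult)
    then obtain k where k: "k \<in> \<A>" "h = (fps_X - fps_const y) * k"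
      using entire_linear_factor_iff[OF h(1)] by blast
    have "a = (\<Prod>x\<leftarrow>y # ys. fps_X - fps_const x) * k"
      using h k by (simp add: mult_ac)
    then show ?case
      using k(1) by blast
  qed
  then obtain h where "h \<in> \<A>" "a = (\<Prod>x\<leftarrow>xs. fps_X - fps_const x) * h"
    using xs by auto
  then have "length xs \<le> N"
    using A xs R by (intro length_le_dominant_index[OF N R(1)]) auto
  then show False
    using xs A distinct_card[OF xs(2)] by simp
qed

section \<open>Orders and the Nevanlinna function\<close>

text \<open>The dominant index at a radius larger than \<open>v x\<close> bounds the powers of
  \<open>fps_X - fps_const x\<close> that can be split off. For the largest one the cofactor cannot
  vanish at \<open>x\<close>.\<close>

lemma entire_order:
  assumes "a \<in> \<A>" "a \<noteq> 0"
  obtains n h where "h \<in> \<A>" "a = (fps_X - fps_const x) ^ n * h" "entire_value v h x \<noteq> 0"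
proof -
  define P where "P n \<longleftrightarrow> (\<exists>h\<in>\<A>. a = (fps_X - fps_const x) ^ n * h)" for n
  define R where "R = v x + 1"
  have R: "R > 0"
    using v_nonneg[of x] by (simp add: R_def)
  obtain N where N: "dominant_index R a N"
    using dominant_index_exists assms R by metis
  have "P 0"
    using assms by (auto simp: P_def)
  moreover have bound: "n \<le> N" if n: "P n" for n
  proof -
    obtain h where "h \<in> \<A>" "a = (\<Prod>x\<leftarrow>replicate n x. fps_X - fps_const x) * h"
      using n unfolding P_def by (auto simp: prod_list_replicate)
    then have "length (replicate n x) \<le> N"
      by (intro length_le_dominant_index[OF N R]) (auto simp: R_def)
    then show ?thesis
      by simp
  qed
  ultimately obtain n where n: "P n" "\<And>m. P m \<Longrightarrow> m \<le> n"
    using GreatestI_nat[of P 0 N] Greatest_le_nat[of P _ N] by metis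
  then obtain h where h: "h \<in> \<A>" "a = (fps_X - fps_const x) ^ n * h"
    unfolding P_def by blast
  have "entire_value v h x \<noteq> 0"
  proof
    assume "entire_value v h x = 0"
    then obtain k where "k \<in> \<A>" "h = (fps_X - fps_const x) * k"
      using entire_linear_factor_iff[OF h(1)] by blast
    then have "P (Suc n)"
      unfolding P_def using h by (auto simp: mult_ac)
    then show False
      using n(2) by fastforce
  qed
  then show ?thesis
    using h that by blast
qed

lemma X_minus_nonzero [simp]: "fps_X - fps_const (x :: 'k) \<noteq> 0"
  using fps_nonzeroI[of "fps_X - fps_const x" 1] by simp

lemma entire_value_nonzero_imp: "entire_value v a x \<noteq> 0 \<Longrightarrow> a \<noteq> 0"
  using entire_value_linear_factor[of 0 x] by auto

text \<open>The definite description in \<open>order_at\<close> needs uniqueness of the exponent: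
  with two different exponents, clearing denominators would equate a function vanishing at
  \<open>x\<close> with one that does not.\<close>

lemma order_at_eqI:
  assumes a: "h \<in> \<A>" "a = (fps_X - fps_const x) ^ n * h" "entire_value v h x \<noteq> 0"
  shows "order_at v x (fps_to_fls a) = int n"
proof -
  let ?L = "fls_X - fls_const x"
  have L: "?L = fps_to_fls (fps_X - fps_const x)"
    by simp
  have L0: "?L \<noteq> 0"
    unfolding L fps_to_fls_eq_0_iff by simp
  have le: "n \<le> m"
    if "c \<in> \<A>" "d \<in> \<A>" "c' \<in> \<A>" "d' \<in> \<A>"
      "entire_value v c x \<noteq> 0" "entire_value v d x \<noteq> 0"
      "entire_value v c' x \<noteq> 0" "entire_value v d' x \<noteq> 0"
      "?L powi n * (fps_to_fls c / fps_to_fls d) = ?L powi m * (fps_to_fls c' / fps_to_fls d')"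
    for n m :: int and c d c' d'
  proof (rule ccontr)
    assume "\<not> n \<le> m"
    then obtain k where k: "n = m + int (Suc k)"
      using zless_iff_Suc_zadd[of m n] by auto
    have nz: "d \<noteq> 0" "d' \<noteq> 0"
      using that entire_value_nonzero_imp by blast+
    have "?L powi n = ?L powi m * ?L ^ Suc k"
      unfolding k using L0 by (simp add: power_int_add power_int_of_nat del: of_nat_Suc power_Suc)
    then have "?L ^ Suc k * fps_to_fls c * fps_to_fls d' = fps_to_fls c' * fps_to_fls d"
    proof -
      define u z where "u = ?L powi m" and "z = ?L ^ Suc k"
      have "u * z * (fps_to_fls c / fps_to_fls d) = u * (fps_to_fls c' / fps_to_fls d')"
        using that(9) \<open>?L powi n = ?L powi m * ?L ^ Suc k\<close> by (simp only: u_def z_def)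
      moreover have "u \<noteq> 0"
        using L0 by (simp add: u_def)
      ultimately show ?thesis
        using nz unfolding z_def[symmetric] by (simp add: field_simps)
    qed
    then have "fps_to_fls ((fps_X - fps_const x) ^ Suc k * c * d') = fps_to_fls (c' * d)"
      by (simp only: L fls_times_fps_to_fls fps_to_fls_power)
    then have "(fps_X - fps_const x) ^ Suc k * c * d' = c' * d"
      by (simp only: fps_to_fls_eq_iff)
    then have "(fps_X - fps_const x) * ((fps_X - fps_const x) ^ k * c * d') = c' * d"
      by (simp add: mult_ac)
    moreover have "entire_value v ((fps_X - fps_const x) * ((fps_X - fps_const x) ^ k * c * d')) x = 0"
      using that by (intro entire_value_linear_factor) simp
    ultimately show False
      using that by (simp add: entire_value_mult)
  qed
  have ex: "fps_to_fls a = ?L powi int n * (fps_to_fls h / fps_to_fls 1)"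
    unfolding a(2) L by (simp only: fls_times_fps_to_fls fps_to_fls_power power_int_of_nat) simp
  show ?thesis
    unfolding order_at_def
  proof (rule the_equality)
    show "\<exists>c\<in>\<A>. \<exists>d\<in>\<A>. entire_value v c x \<noteq> 0 \<and> entire_value v d x \<noteq> 0 \<and>
        fps_to_fls a = ?L powi int n * (fps_to_fls c / fps_to_fls d)"
      using ex a by (intro bexI[of _ h] bexI[of _ 1]) auto
  next
    fix m assume "\<exists>c\<in>\<A>. \<exists>d\<in>\<A>. entire_value v c x \<noteq> 0 \<and> entire_value v d x \<noteq> 0 \<and>
        fps_to_fls a = ?L powi m * (fps_to_fls c / fps_to_fls d)"
    then obtain c d where cd: "c \<in> \<A>" "d \<in> \<A>" "entire_value v c x \<noteq> 0" "entire_value v d x \<noteq> 0"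
      "fps_to_fls a = ?L powi m * (fps_to_fls c / fps_to_fls d)"
      by blast
    have "m \<le> int n"
      by (rule le[of c d h 1]) (use cd a ex in auto)
    moreover have "int n \<le> m"
      by (rule le[of h 1 c d]) (use cd a ex in auto)
    ultimately show "m = int n"
      by simp
  qed
qed

lemma order_at_pos_imp_zero:
  assumes "a \<in> \<A>" "a \<noteq> 0" "order_at v x (fps_to_fls a) > 0"
  shows "entire_value v a x = 0"
proof -
  obtain n h where h: "h \<in> \<A>" "a = (fps_X - fps_const x) ^ n * h" "entire_value v h x \<noteq> 0"
    using entire_order assms by metis
  then have "n > 0"
    using order_at_eqI[OF h] assms by simp
  then obtain m where "n = Suc m"
    by (cases n) auto
  then have "a = (fps_X - fps_const x) * ((fps_X - fps_const x) ^ m * h)"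
    using h(2) by (simp only: power_Suc mult.assoc)
  then show ?thesis
    using entire_value_linear_factor[of "(fps_X - fps_const x) ^ m * h" x] h(1) by simp
qed

text \<open>Collecting the factors that belong to \<open>x\<close> splits off a power of
  \<open>fps_X - fps_const x\<close>. Were the order smaller, cancelling would make its cofactor
  vanish at \<open>x\<close>.\<close>

lemma count_list_le_order_at:
  assumes "h \<in> \<A>" "a = (\<Prod>x\<leftarrow>xs. fps_X - fps_const x) * h" "a \<noteq> 0"
  shows "int (count_list xs x) \<le> order_at v x (fps_to_fls a)"
proof -
  have "\<exists>g\<in>\<A>. (\<Prod>x\<leftarrow>xs. fps_X - fps_const x) = (fps_X - fps_const x) ^ count_list xs x * g"
  proof (induction xs)
    case (Cons y ys)
    then obtain g where g: "g \<in> \<A>"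
      "(\<Prod>x\<leftarrow>ys. fps_X - fps_const x) = (fps_X - fps_const x) ^ count_list ys x * g"
      by blast
    show ?case
    proof (cases "y = x")
      case True
      then show ?thesis
        using g by (intro bexI[of _ g]) (auto simp: mult_ac)
    next
      case False
      then show ?thesis
        using g by (intro bexI[of _ "(fps_X - fps_const y) * g"]) (auto simp: mult_ac)
    qed
  qed (auto intro: bexI[of _ 1])
  then obtain g where g: "g \<in> \<A>" "a = (fps_X - fps_const x) ^ count_list xs x * (g * h)"
    using assms by (auto simp: mult_ac)
  obtain n k where k: "k \<in> \<A>" "a = (fps_X - fps_const x) ^ n * k" "entire_value v k x \<noteq> 0"
  proof -
    have "a \<in> \<A>"
      unfolding g(2) using assms(1) g(1) by (intro entire_mult entire_power) auto
    then show ?thesis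
      using entire_order assms(3) that by blast
  qed
  have "count_list xs x \<le> n"
  proof (rule ccontr)
    assume "\<not> count_list xs x \<le> n"
    then obtain m where m: "count_list xs x = n + Suc m"
      by (metis less_natE not_le add_Suc_right)
    have "(fps_X - fps_const x) ^ n * k = (fps_X - fps_const x) ^ n *
        ((fps_X - fps_const x) * ((fps_X - fps_const x) ^ m * g * h))"
      using k(2) g(2) unfolding m by (simp add: power_add mult_ac)
    then have "k = (fps_X - fps_const x) * ((fps_X - fps_const x) ^ m * g * h)"
      by (subst (asm) mult_cancel_left) simp
    then have "entire_value v k x = 0"
      using entire_value_linear_factor[of "(fps_X - fps_const x) ^ m * g * h" x] g assms(1) by simp
    then show False
      using k by simp
  qed
  then show ?thesis
    using order_at_eqI[OF k] by simp
qed

lemma sum_list_eq_sum_count_list: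
  fixes f :: "'b \<Rightarrow> real"
  assumes "finite S" "set xs \<subseteq> S"
  shows "(\<Sum>x\<leftarrow>xs. f x) = (\<Sum>x\<in>S. real (count_list xs x) * f x)"
  using assms(2)
proof (induction xs)
  case (Cons y xs)
  have "(\<Sum>x\<in>S. real (count_list (y # xs) x) * f x) =
      (\<Sum>x\<in>S. real (count_list xs x) * f x + (if x = y then f x else 0))"
    by (intro sum.cong) (auto simp: algebra_simps)
  also have "\<dots> = (\<Sum>x\<in>S. real (count_list xs x) * f x) + f y"
    using Cons assms(1) by (simp add: sum.distrib sum.delta)
  finally show ?case
    using Cons by simp
qed simp

text \<open>The case \<open>y = 0\<close> rests on the conventions \<open>x / 0 = 0\<close> and
  \<open>ln 0 = 0\<close>.\<close>

lemma ln_ratio_nonneg: "0 \<le> y \<Longrightarrow> y \<le> x \<Longrightarrow> 0 \<le> ln (x / y)" for x y :: real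
  by (cases "y = 0") auto

lemma nev_Z_nonneg: "0 \<le> nev_Z v \<rho> h"
  unfolding nev_Z_def by (intro sum_nonneg mult_nonneg_nonneg ln_ratio_nonneg) (auto simp: v_nonneg)

lemma nev_T_nonneg: "0 \<le> nev_T v \<rho> h"
  using nev_Z_nonneg by (simp add: nev_T_def le_max_iff_disj)

text \<open>Each listed zero \<open>x\<close> contributes \<open>ln \<rho> - ln (v x)\<close> once
  \<open>\<rho>\<close> is at least every \<open>v x\<close>, repetitions being covered by the
  orders. The constant \<open>C\<close> collects the \<open>ln (v x)\<close>.\<close>

lemma nev_Z_ge:
  assumes "h \<in> \<A>" "a = (\<Prod>x\<leftarrow>xs. fps_X - fps_const x) * h" "a $ 0 \<noteq> 0"
  obtains C r where "r > 0"
    "\<And>\<rho>. \<rho> \<ge> r \<Longrightarrow> nev_Z v \<rho> (fps_to_fls a) \<ge> real (length xs) * ln \<rho> - C"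
proof
  define r where "r = Max (insert 1 (v ` set xs))"
  have r1: "r \<ge> 1"
    unfolding r_def by (intro Max_ge) auto
  have rx: "v x \<le> r" if "x \<in> set xs" for x
    unfolding r_def using that by (intro Max_ge) auto
  show "r > 0"
    using r1 by simp
  have a0: "a \<noteq> 0"
    using assms(3) by auto
  have aA: "a \<in> \<A>"
    unfolding assms(2) by (intro entire_mult entire_prod_list assms(1)) auto
  have "(\<Prod>x\<leftarrow>xs. fps_X - fps_const x) $ 0 \<noteq> 0"
    using assms(2,3) by (metis fps_mult_nth_0 mult_zero_left)
  then have nz: "0 \<notin> set xs"
    by (induction xs) auto
  show "nev_Z v \<rho> (fps_to_fls a) \<ge> real (length xs) * ln \<rho> - (\<Sum>x\<leftarrow>xs. ln (v x))"
    if "\<rho> \<ge> r" for \<rho>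
  proof -
    let ?o = "\<lambda>x. order_at v x (fps_to_fls a)"
    let ?S = "{x. ?o x > 0 \<and> v x \<le> \<rho>}"
    have fin: "finite ?S"
      by (rule finite_subset[OF _ finite_zeros[OF aA a0, of \<rho>]])
        (use order_at_pos_imp_zero[OF aA a0] in auto)
    have cnt: "int (count_list xs x) \<le> ?o x" for x
      by (rule count_list_le_order_at) (use assms a0 in auto)
    have sub: "set xs \<subseteq> ?S"
    proof
      fix x assume x: "x \<in> set xs"
      then have "count_list xs x > 0"
        by (meson count_list_0_iff gr0I)
      then have "?o x > 0"
        using cnt[of x] by linarith
      then show "x \<in> ?S"
        using rx[OF x] that by simp
    qed
    have "(\<Sum>x\<leftarrow>xs. ln (\<rho> / v x)) = (\<Sum>x\<in>?S. real (count_list xs x) * ln (\<rho> / v x))"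
      by (rule sum_list_eq_sum_count_list[OF fin sub])
    also have "\<dots> \<le> (\<Sum>x\<in>?S. real_of_int (?o x) * ln (\<rho> / v x))"
    proof (intro sum_mono mult_right_mono ln_ratio_nonneg)
      fix x show "real (count_list xs x) \<le> real_of_int (?o x)"
        using cnt[of x] by linarith
    qed (auto simp: v_nonneg)
    finally have "(\<Sum>x\<leftarrow>xs. ln (\<rho> / v x)) \<le> nev_Z v \<rho> (fps_to_fls a)"
      by (simp add: nev_Z_def)
    moreover have "(\<Sum>x\<leftarrow>ys. ln (\<rho> / v x)) = real (length ys) * ln \<rho> - (\<Sum>x\<leftarrow>ys. ln (v x))"
      if "0 \<notin> set ys" for ys
      using that
    proof (induction ys)
      case (Cons y ys)
      then have "v y > 0"
        by (auto intro: v_pos)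
      then show ?case
        using Cons \<open>\<rho> \<ge> r\<close> r1 by (simp add: ln_div algebra_simps)
    qed simp
    ultimately show ?thesis
      using nz by simp
  qed
qed

end

section \<open>Substituting power series into polynomials\<close>

text \<open>Substitution is polynomial evaluation with coefficients embedded as constants;
  \<open>f\<close> may thus have a nonzero constant term, in contrast to composition of power
  series.\<close>

definition fps_poly :: "'k::field poly \<Rightarrow> 'k fps \<Rightarrow> 'k fps" where
  "fps_poly U f = poly (map_poly fps_const U) f"

lemma fps_poly_0 [simp]: "fps_poly 0 f = 0"
  by (simp add: fps_poly_def)

lemma fps_poly_pCons [simp]: "fps_poly (pCons a U) f = fps_const a + f * fps_poly U f"
  by (simp add: fps_poly_def map_poly_pCons)

lemma fps_poly_1 [simp]: "fps_poly 1 f = 1"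
  by (simp add: one_pCons)

lemma fps_poly_add [simp]: "fps_poly (U + V) f = fps_poly U f + fps_poly V f"
  by (induction U V rule: poly_induct2)
    (simp_all add: algebra_simps flip: fps_const_add)

lemma fps_poly_smult [simp]: "fps_poly (smult c U) f = fps_const c * fps_poly U f"
  by (induction U) (simp_all add: algebra_simps flip: fps_const_mult)

lemma fps_poly_diff [simp]: "fps_poly (U - V) f = fps_poly U f - fps_poly V f"
  using fps_poly_add[of "U - V" V f] by simp

lemma fps_poly_mult [simp]: "fps_poly (U * V) f = fps_poly U f * fps_poly V f"
  by (induction U) (simp_all add: algebra_simps)

lemma fps_poly_power [simp]: "fps_poly (U ^ n) f = fps_poly U f ^ n"
  by (induction n) simp_all

lemma fps_poly_prod: "fps_poly (\<Prod>x\<in>A. U x) f = (\<Prod>x\<in>A. fps_poly (U x) f)"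
  by (induction A rule: infinite_finite_induct) simp_all

lemma fps_poly_linear [simp]: "fps_poly [:- c, 1:] f = f - fps_const c"
  by (simp flip: fps_const_neg)

lemma fps_deriv_fps_poly: "fps_deriv (fps_poly U f) = fps_poly (pderiv U) f * fps_deriv f"
  by (induction U) (simp_all add: pderiv_pCons algebra_simps)

lemma fps_poly_compose:
  "g $ 0 = 0 \<Longrightarrow> fps_poly U f oo g = fps_poly U (f oo g)"
  by (induction U) (simp_all add: fps_compose_add_distrib fps_compose_mult_distrib)

lemma poly_map_fls_const:
  "poly (map_poly fls_const U) (fps_to_fls f) = fps_to_fls (fps_poly U f)"
  by (induction U) (simp_all add: map_poly_pCons fls_times_fps_to_fls)

section \<open>Bezout identities and coprimality\<close>

text \<open>Among the nonzero combinations of \<open>a\<close> and \<open>b\<close>, one of least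
  degree divides every combination, by division with remainder; as a common divisor it is a
  unit.\<close>

lemma poly_bezout:
  fixes a b :: "'a::field poly"
  assumes "coprime a b"
  obtains x y where "x * a + y * b = 1"
proof -
  have nz: "a \<noteq> 0 \<or> b \<noteq> 0"
    using assms by auto
  define I where "I d \<longleftrightarrow> d \<noteq> 0 \<and> (\<exists>x y. d = x * a + y * b)" for d
  have "I a \<or> I b"
    unfolding I_def using nz by (metis add.left_neutral add.right_neutral mult_1 mult_zero_left)
  then obtain d where d: "I d" and least: "\<And>e. I e \<Longrightarrow> degree d \<le> degree e"
    using ex_has_least_nat[of I _ degree] by metis
  obtain x y where xy: "d = x * a + y * b" and d0: "d \<noteq> 0"
    using d unfolding I_def by blast
  have dvd: "d dvd c" if "c = x' * a + y' * b" for c x' y'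
  proof (rule ccontr)
    assume "\<not> d dvd c"
    then have m0: "c mod d \<noteq> 0"
      by (simp add: mod_eq_0_iff_dvd)
    have "c mod d = c - (c div d) * d"
      by (simp add: minus_div_mult_eq_mod)
    also have "\<dots> = (x' - (c div d) * x) * a + (y' - (c div d) * y) * b"
      unfolding that xy by (simp add: algebra_simps)
    finally have "I (c mod d)"
      unfolding I_def using m0 by blast
    then show False
      using least[of "c mod d"] degree_mod_less'[OF d0 m0] by simp
  qed
  have "d dvd a" "d dvd b"
    using dvd[of a 1 0] dvd[of b 0 1] by simp_all
  then have "is_unit d"
    using assms by (simp add: coprime_def)
  then obtain e where "d * e = 1"
    by (metis dvdE)
  then have "(e * x) * a + (e * y) * b = 1"
    unfolding xy by (simp add: algebra_simps)
  then show ?thesis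
    using that by blast
qed

lemma coprime_if_no_common_root:
  fixes a b :: "'a::alg_closed_field poly"
  assumes "a \<noteq> 0" "\<And>x. poly a x = 0 \<Longrightarrow> poly b x \<noteq> 0"
  shows "coprime a b"
proof (rule coprimeI)
  fix c assume c: "c dvd a" "c dvd b"
  have "c \<noteq> 0"
    using c assms(1) by auto
  have "degree c = 0"
  proof (rule ccontr)
    assume "degree c \<noteq> 0"
    then obtain x where "poly c x = 0"
      using alg_closed_imp_poly_has_root[of c] by auto
    then have "poly a x = 0" "poly b x = 0"
      using c by (auto elim!: dvdE)
    then show False
      using assms(2) by blast
  qed
  then show "is_unit c"
    using \<open>c \<noteq> 0\<close> by (simp add: is_unit_iff_degree)
qed

section \<open>Series in a power of the variable\<close>

lemma compose_X_power_inj: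
  fixes a b :: "'a::comm_ring_1 fps"
  assumes "a oo fps_X ^ n = b oo fps_X ^ n" "n > 0"
  shows "a = b"
proof (rule fps_ext)
  fix i
  show "a $ i = b $ i"
    using arg_cong[OF assms(1), of "\<lambda>h. h $ (n * i)"] assms(2)
    by (simp add: fps_nth_compose_X_power)
qed

lemma compose_X_power_power:
  fixes a :: "'a::comm_ring_1 fps"
  assumes "n > 0"
  shows "(a oo fps_X ^ m) oo fps_X ^ n = a oo fps_X ^ (n * m)"
proof (rule fps_ext)
  fix i
  have "n dvd i \<and> m dvd i div n \<longleftrightarrow> n * m dvd i"
    using assms by (auto elim!: dvdE simp: mult.assoc)
  then show "((a oo fps_X ^ m) oo fps_X ^ n) $ i = (a oo fps_X ^ (n * m)) $ i"
    by (auto simp: fps_nth_compose_X_power div_mult2_eq)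
qed

text \<open>Where the characteristic does not divide \<open>n\<close>, the factor
  \<open>of_nat n\<close> is invertible and forces the coefficient to vanish. In characteristic 0
  the composition is with \<open>fps_X ^ 0 = 1\<close>, and the conclusion says that
  \<open>f\<close> is constant.\<close>

lemma fps_deriv_eq_0_imp_compose:
  fixes f :: "'a::field fps"
  assumes "fps_deriv f = 0"
  obtains g where "f = g oo fps_X ^ CHAR('a)"
proof
  have "f $ n = 0" if "\<not> CHAR('a) dvd n" for n
  proof (cases n)
    case (Suc m)
    have "of_nat n * f $ n = 0"
      using arg_cong[OF assms, of "\<lambda>h. h $ m"] Suc by simp
    then show ?thesis
      using that by (simp add: of_nat_eq_0_iff_char_dvd)
  qed (use that in simp)
  moreover have "CHAR('a) * (n div CHAR('a)) = n" if "CHAR('a) dvd n" for n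
    using that by simp
  ultimately show "f = Abs_fps (\<lambda>i. f $ (CHAR('a) * i)) oo fps_X ^ CHAR('a)"
    by (intro fps_ext) (simp add: fps_nth_compose_X_power)
qed

lemma fps_const_iff_deriv_nonzero: "fps_deriv f \<noteq> 0 \<Longrightarrow> f \<notin> range fps_const"
  by auto

section \<open>Frobenius and roots of characteristic-power order\<close>

text \<open>Frobenius: \<open>n\<close>-th powers are additive. The series is cut after index
  \<open>m\<close>; the \<open>n\<close>-th power of the rest starts beyond degree \<open>m\<close>,
  and that of the finite part is taken term by term.\<close>

lemma fps_power_char_power_nth:
  fixes u :: "'a::field fps"
  assumes "CHAR('a) > 0" "n = CHAR('a) ^ t"
  shows "(u ^ n) $ m = (if n dvd m then (u $ (m div n)) ^ n else 0)"
proof -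
  have p: "prime CHAR('a fps)"
    using prime_CHAR_semidom[OF assms(1)] by simp
  have n: "n = CHAR('a fps) ^ t" "n > 0"
    using assms by auto
  have "u = fps_X ^ Suc m * fps_shift (Suc m) u + (\<Sum>i\<le>m. fps_const (u $ i) * fps_X ^ i)"
  proof -
    have "fps_cutoff (Suc m) u = (\<Sum>i\<le>m. fps_const (u $ i) * fps_X ^ i)"
      by (rule fps_ext) (auto simp: fps_sum_nth fps_X_power_nth if_distrib less_Suc_eq_le
        cong: if_cong)
    then show ?thesis
      using fps_shift_cutoff'[of "Suc m" u] by simp
  qed
  then have "u ^ n = (fps_X ^ Suc m * fps_shift (Suc m) u) ^ n
      + (\<Sum>i\<le>m. fps_const (u $ i) * fps_X ^ i) ^ n"
    using freshmans_dream'[OF p n(1)] by metis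
  also have "\<dots> = fps_X ^ (Suc m * n) * fps_shift (Suc m) u ^ n
      + (\<Sum>i\<le>m. fps_const ((u $ i) ^ n) * fps_X ^ (i * n))"
    unfolding freshmans_dream_sum'[OF p n(1)]
    by (simp only: power_mult_distrib fps_const_power power_mult)
  finally have "(u ^ n) $ m = (fps_X ^ (Suc m * n) * fps_shift (Suc m) u ^ n) $ m
      + (\<Sum>i\<le>m. (u $ i) ^ n * (if m = i * n then 1 else 0))"
    by (simp add: fps_sum_nth fps_X_power_nth del: power_Suc mult_Suc)
  also have "(fps_X ^ (Suc m * n) * fps_shift (Suc m) u ^ n) $ m = 0"
  proof -
    have "m < Suc m * n"
      using n(2) by (metis less_Suc_eq less_le_trans mult.right_neutral mult_le_mono2 Suc_leI One_nat_def)
    then show ?thesis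
      by (simp add: fps_X_power_mult_nth del: mult_Suc)
  qed
  also have "0 + (\<Sum>i\<le>m. (u $ i) ^ n * (if m = i * n then 1 else 0))
      = (\<Sum>i\<in>{i. i \<le> m \<and> m = i * n}. (u $ i) ^ n)"
    by (simp add: if_distrib sum.If_cases Int_def cong: if_cong)
  also have "{i. i \<le> m \<and> m = i * n} = (if n dvd m then {m div n} else {})"
    using n(2) by auto
  finally show ?thesis
    by (auto split: if_splits)
qed

text \<open>Injectivity of the iterated Frobenius: the difference of two elements with equal
  \<open>n\<close>-th powers has \<open>n\<close>-th power 0.\<close>

lemma fls_char_power_eq:
  fixes x y :: "'a::field fls"
  assumes "CHAR('a) > 0" "x ^ (CHAR('a) ^ s) = y ^ (CHAR('a) ^ t)" "s \<le> t"
  shows "x = y ^ (CHAR('a) ^ (t - s))"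
proof -
  define z where "z = y ^ (CHAR('a) ^ (t - s))"
  define n where "n = CHAR('a) ^ s"
  have p: "prime CHAR('a fls)"
    using prime_CHAR_semidom[OF assms(1)] by simp
  have n: "n = CHAR('a fls) ^ s" "n > 0"
    using assms(1) by (auto simp: n_def)
  have "z ^ n = x ^ n"
    using assms(2,3) unfolding z_def n_def by (simp flip: power_mult power_add)
  moreover have "(z + (x - z)) ^ n = z ^ n + (x - z) ^ n"
    by (rule freshmans_dream'[OF p n(1)])
  ultimately have "(x - z) ^ n = 0"
    by simp
  then show ?thesis
    using n(2) by (simp add: z_def)
qed

text \<open>Gives uniqueness of the ramification index: if \<open>s < t\<close>, then
  \<open>x\<close> is a proper characteristic power of \<open>y\<close>, so its derivative vanishes;
  the case \<open>t < s\<close> is symmetric.\<close>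

lemma fls_char_power_deriv_inj:
  fixes x y :: "'a::field fls"
  assumes "CHAR('a) > 0" "x ^ (CHAR('a) ^ s) = y ^ (CHAR('a) ^ t)"
    and "fls_deriv x \<noteq> 0" "fls_deriv y \<noteq> 0"
  shows "s = t"
proof -
  have *: "\<not> s < t"
    if "x ^ (CHAR('a) ^ s) = y ^ (CHAR('a) ^ t)" "fls_deriv x \<noteq> 0" for x y :: "'a fls" and s t
  proof
    assume "s < t"
    then have "x = y ^ (CHAR('a) ^ (t - s))"
      using fls_char_power_eq[OF assms(1) that(1)] by simp
    moreover have "of_nat (CHAR('a) ^ (t - s)) = (0 :: 'a fls)"
      using \<open>s < t\<close> by (simp add: of_nat_eq_0_iff_char_dvd)
    ultimately show False
      using that(2) by (simp add: fls_deriv_power)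
  qed
  show ?thesis
    using *[OF assms(2,3)] *[OF assms(2)[symmetric] assms(4)] by simp
qed

context complete_nonarch_field
begin

lemma entire_fps_poly [simp]: "f \<in> \<A> \<Longrightarrow> fps_poly U f \<in> \<A>"
  by (induction U) auto

lemma entire_of_compose_X_power:
  assumes "f oo fps_X ^ n \<in> \<A>" "n > 0"
  shows "f \<in> \<A>"
proof (rule entireI)
  fix r :: real assume r: "r > 0"
  have "root n r > 0"
    using r assms(2) by simp
  then obtain C where C: "\<And>i. v ((f oo fps_X ^ n) $ i) * root n r ^ i \<le> C"
    using entire_bounded[OF assms(1)] by metis
  have "v (f $ i) * r ^ i \<le> C" for i
    using C[of "n * i"] r assms(2) by (simp add: fps_nth_compose_X_power power_mult)
  then show "\<exists>C. \<forall>i. v (f $ i) * r ^ i \<le> C"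
    by blast
qed

lemma gauss_norm_compose_X_power_ge:
  assumes "f oo fps_X ^ n \<in> \<A>" "n > 0" "r > 0"
  shows "gauss_norm (r ^ n) f \<le> gauss_norm r (f oo fps_X ^ n)"
proof (rule gauss_norm_leI)
  fix i
  show "v (f $ i) * (r ^ n) ^ i \<le> gauss_norm r (f oo fps_X ^ n)"
    using v_nth_le_gauss_norm[OF assms(1,3), of "n * i"] assms(2)
    by (simp add: fps_nth_compose_X_power power_mult)
qed

text \<open>In positive characteristic, \<open>n\<close>-th roots of the coefficients of
  \<open>F\<close> form a series \<open>u\<close> with \<open>u ^ n = F oo fps_X ^ n\<close> by
  Frobenius. It is entire, and its derivative is nonzero because \<open>u\<close> and
  \<open>F\<close> have nonzero coefficients at the same indices.\<close>

lemma ramification_index_eqI: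
  assumes "F oo fps_X ^ (char_exponent TYPE('k) ^ t) \<in> \<A>" "fps_deriv F \<noteq> 0"
    and "CHAR('k) = 0 \<Longrightarrow> t = 0"
  shows "ramification_index v (fps_to_fls (F oo fps_X ^ (char_exponent TYPE('k) ^ t))) = t"
proof (cases "CHAR('k) = 0")
  case True
  then show ?thesis
    using assms(3) by (simp add: ramification_index_def)
next
  case False
  then have e: "char_exponent TYPE('k) = CHAR('k)"
    by (simp add: char_exponent_def)
  define n where "n = CHAR('k) ^ t"
  have n: "n > 0"
    using False by (simp add: n_def)
  have F: "F \<in> \<A>"
    using entire_of_compose_X_power[OF assms(1)] False e by simp
  obtain w where w: "\<And>i. w i ^ n = F $ i"
    using choice[of "\<lambda>i y. y ^ n = F $ i"] nth_root_exists[OF n] by blast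
  define u where "u = Abs_fps w"
  have un: "u ^ n = F oo fps_X ^ n"
    using fps_power_char_power_nth[of n t u] False w
    by (intro fps_ext) (simp add: n_def u_def fps_nth_compose_X_power)
  have "u \<in> \<A>"
  proof (rule entireI)
    fix r :: real assume r: "r > 0"
    then obtain C where C: "\<And>i. v (F $ i) * (r ^ n) ^ i \<le> C"
      using entire_bounded[OF F, of "r ^ n"] by auto
    \<comment> \<open>A term above 1 is at most its own \<open>n\<close>-th power, which is a term
      of \<open>F\<close> at radius \<open>r ^ n\<close>.\<close>
    have "v (u $ i) * r ^ i \<le> max 1 C" for i
    proof (cases "v (u $ i) * r ^ i \<le> 1")
      case False
      then have "(v (u $ i) * r ^ i) ^ 1 \<le> (v (u $ i) * r ^ i) ^ n"
        using n by (intro power_increasing) auto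
      also have "\<dots> = v (w i ^ n) * (r ^ n) ^ i"
        by (simp add: u_def power_mult_distrib v_power mult.commute flip: power_mult)
      also have "\<dots> \<le> C"
        unfolding w by (rule C)
      finally show ?thesis
        by simp
    qed simp
    then show "\<exists>C. \<forall>i. v (u $ i) * r ^ i \<le> C"
      by blast
  qed
  then have u: "fps_to_fls u \<in> meromorphic_functions v"
    unfolding meromorphic_functions_def
    by (intro CollectI exI[of _ u] exI[of _ 1]) auto
  have un': "fps_to_fls u ^ n = fps_to_fls (F oo fps_X ^ n)"
    by (simp only: un flip: fps_to_fls_power)
  obtain i where "of_nat (Suc i) * F $ Suc i \<noteq> 0"
    using assms(2) by (auto simp: fps_eq_iff)
  then have "of_nat (Suc i) * u $ Suc i \<noteq> 0"
    using w[of "Suc i"] n unfolding u_def by (metis fps_nth_Abs_fps mult_eq_0_iff zero_power)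
  then have "fps_deriv u \<noteq> 0"
    by (metis fps_deriv_nth fps_zero_nth add.commute Suc_eq_plus1 plus_1_eq_Suc)
  then have u': "fls_deriv (fps_to_fls u) \<noteq> 0"
    by (simp add: fls_deriv_fps_to_fls)
  have "s = t" if "w \<in> meromorphic_functions v" "w ^ (CHAR('k) ^ s) = fps_to_fls (F oo fps_X ^ n)"
    "fls_deriv w \<noteq> 0" for s w
    using fls_char_power_deriv_inj[of w s "fps_to_fls u" t] that un' u' False by (simp add: n_def)
  then show ?thesis
    unfolding ramification_index_def e using False un' u u' unfolding n_def
    by (auto intro!: the_equality bexI[of _ "fps_to_fls u"])
qed

section \<open>Gauss norms of compositions\<close>

lemma gauss_norm_at_top:
  assumes "f \<in> \<A>" "f \<notin> range fps_const"
  shows "filterlim (\<lambda>r. gauss_norm r f) at_top at_top"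
proof -
  have "f \<noteq> fps_const (f $ 0)"
    using assms(2) by blast
  then obtain j where "f $ j \<noteq> fps_const (f $ 0) $ j"
    by (auto simp: fps_eq_iff)
  then have j: "j > 0" "f $ j \<noteq> 0"
    by (cases j; simp)+
  have "filterlim (\<lambda>r. v (f $ j) * r) at_top at_top"
    using v_pos[OF j(2)] by (intro filterlim_tendsto_pos_mult_at_top[OF tendsto_const]) (auto simp: filterlim_ident)
  moreover have "eventually (\<lambda>r. v (f $ j) * r \<le> gauss_norm r f) at_top"
    using eventually_ge_at_top[of 1]
  proof eventually_elim
    case (elim r)
    have "r ^ 1 \<le> r ^ j"
      using elim j by (intro power_increasing) auto
    then have "v (f $ j) * r \<le> v (f $ j) * r ^ j"
      by (intro mult_left_mono v_nonneg) auto
    also have "\<dots> \<le> gauss_norm r f"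
      using elim assms(1) by (intro v_nth_le_gauss_norm) auto
    finally show ?case .
  qed
  ultimately show ?thesis
    by (rule filterlim_at_top_mono)
qed

lemma gauss_norm_fps_poly_le:
  assumes "f \<in> \<A>" "f \<notin> range fps_const"
  obtains C where "C > 0"
    "eventually (\<lambda>r. gauss_norm r (fps_poly U f) \<le> C * gauss_norm r f ^ degree U) at_top"
proof -
  have "\<exists>C>0. eventually (\<lambda>r. gauss_norm r (fps_poly U f) \<le> C * gauss_norm r f ^ degree U) at_top"
  proof (induction U)
    case 0
    show ?case
      by (intro exI[of _ 1]) auto
  next
    case (pCons a U)
    then obtain C where C: "C > 0"
      "eventually (\<lambda>r. gauss_norm r (fps_poly U f) \<le> C * gauss_norm r f ^ degree U) at_top"
      by blast
    have f1: "eventually (\<lambda>r. 1 \<le> gauss_norm r f) at_top"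
      using gauss_norm_at_top[OF assms] by (auto simp: filterlim_at_top)
    have "eventually (\<lambda>r. gauss_norm r (fps_poly (pCons a U) f)
        \<le> (C + v a + 1) * gauss_norm r f ^ degree (pCons a U)) at_top"
      using C(2) f1 eventually_gt_at_top[of 0]
    proof eventually_elim
      case (elim r)
      define g where "g = gauss_norm r f"
      have le: "gauss_norm r (f * fps_poly U f) \<le> C * g ^ degree (pCons a U)"
      proof (cases "U = 0")
        case False
        then show ?thesis
          using elim assms(1) by (simp add: gauss_norm_mult g_def mult_left_mono mult.left_commute)
      qed (use C(1) in simp)
      have "1 \<le> g ^ degree (pCons a U)"
        using elim by (simp add: g_def one_le_power)
      then have "v a \<le> v a * g ^ degree (pCons a U)"
        using v_nonneg[of a] by (simp add: mult_le_cancel_left1)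
      moreover have "gauss_norm r (fps_poly (pCons a U) f) \<le> max (v a) (gauss_norm r (f * fps_poly U f))"
        using gauss_norm_add_le[of "fps_const a" "f * fps_poly U f" r] elim assms(1) by simp
      moreover have "0 \<le> C * g ^ degree (pCons a U)" "0 \<le> v a * g ^ degree (pCons a U)"
        using C(1) elim by (simp_all add: g_def v_nonneg)
      ultimately have "gauss_norm r (fps_poly (pCons a U) f)
          \<le> C * g ^ degree (pCons a U) + v a * g ^ degree (pCons a U) + g ^ degree (pCons a U)"
        using le \<open>1 \<le> g ^ degree (pCons a U)\<close> by linarith
      then show ?case
        by (simp add: g_def algebra_simps)
    qed
    then show ?case
      using C(1) v_nonneg[of a] by (intro exI[of _ "C + v a + 1"]) auto
  qed
  then show ?thesis
    using that by blast
qed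

text \<open>Horner induction: for large \<open>r\<close> the summand containing \<open>f\<close>
  strictly exceeds the constant \<open>a\<close>, so by the isosceles principle adding
  \<open>a\<close> does not change the norm.\<close>

lemma gauss_norm_fps_poly_ge:
  assumes "f \<in> \<A>" "f \<notin> range fps_const" "U \<noteq> 0"
  obtains c where "c > 0"
    "eventually (\<lambda>r. c * gauss_norm r f ^ degree U \<le> gauss_norm r (fps_poly U f)) at_top"
proof -
  have "\<exists>c>0. eventually (\<lambda>r. c * gauss_norm r f ^ degree U \<le> gauss_norm r (fps_poly U f)) at_top"
    using assms(3)
  proof (induction U)
    case (pCons a U)
    show ?case
    proof (cases "U = 0")
      case True
      then have "v a > 0"
        using pCons v_pos by auto
      moreover have "eventually (\<lambda>r. v a * gauss_norm r f ^ degree (pCons a U)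
          \<le> gauss_norm r (fps_poly (pCons a U) f)) at_top"
        using eventually_gt_at_top[of 0] by eventually_elim (simp add: True)
      ultimately show ?thesis
        by blast
    next
      case False
      then obtain c where c: "c > 0"
        "eventually (\<lambda>r. c * gauss_norm r f ^ degree U \<le> gauss_norm r (fps_poly U f)) at_top"
        using pCons by blast
      have "eventually (\<lambda>r. 1 + (v a + 1) / c \<le> gauss_norm r f) at_top"
        using gauss_norm_at_top[OF assms(1,2)] by (auto simp: filterlim_at_top)
      then have "eventually (\<lambda>r. c * gauss_norm r f ^ degree (pCons a U)
          \<le> gauss_norm r (fps_poly (pCons a U) f)) at_top"
        using c(2) eventually_gt_at_top[of 0]
      proof eventually_elim
        case (elim r)
        define g where "g = gauss_norm r f"
        have g1: "1 \<le> g" and ag: "v a < c * g"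
        proof -
          have "0 \<le> (v a + 1) / c"
            using c(1) v_nonneg[of a] by simp
          then show "1 \<le> g"
            using elim(1) unfolding g_def by linarith
          have "(v a + 1) / c < g"
            using elim(1) unfolding g_def by linarith
          then show "v a < c * g"
            using c(1) by (simp add: field_simps)
        qed
        have "g ^ 1 \<le> g ^ degree (pCons a U)"
          using g1 False by (intro power_increasing) auto
        then have "c * g \<le> c * g ^ degree (pCons a U)"
          using c(1) by simp
        also have le: "c * g ^ degree (pCons a U) \<le> gauss_norm r (f * fps_poly U f)"
          using elim assms(1) False g1 c(1)
          by (simp add: gauss_norm_mult g_def mult_left_mono mult.left_commute)
        finally have "gauss_norm r (fps_const a) < gauss_norm r (f * fps_poly U f)"
          using ag elim by simp
        then have "gauss_norm r (fps_poly (pCons a U) f) = gauss_norm r (f * fps_poly U f)"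
          using elim assms(1) by (simp add: gauss_norm_add_eq)
        then show ?case
          using le by (simp add: g_def)
      qed
      then show ?thesis
        using c(1) by blast
    qed
  qed simp
  then show ?thesis
    using that by blast
qed

lemma fps_poly_nonzero:
  assumes "f \<in> \<A>" "f \<notin> range fps_const" "U \<noteq> 0"
  shows "fps_poly U f \<noteq> 0"
proof
  assume 0: "fps_poly U f = 0"
  obtain c where c: "c > 0"
    "eventually (\<lambda>r. c * gauss_norm r f ^ degree U \<le> gauss_norm r (fps_poly U f)) at_top"
    using gauss_norm_fps_poly_ge[OF assms] .
  have "eventually (\<lambda>r. 1 \<le> gauss_norm r f) at_top"
    using gauss_norm_at_top[OF assms(1,2)] by (auto simp: filterlim_at_top)
  with c(2) have "eventually (\<lambda>r::real. False) at_top"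
  proof eventually_elim
    case (elim r)
    then have "1 \<le> gauss_norm r f ^ degree U"
      by (intro one_le_power)
    then have "c \<le> c * gauss_norm r f ^ degree U"
      using c(1) by simp
    then show ?case
      using elim(1) c(1) unfolding 0 gauss_norm_0 by linarith
  qed
  then show False
    by simp
qed

lemma gauss_norm_ge_const:
  assumes "h \<in> \<A>" "h \<noteq> 0"
  obtains c where "c > 0" "eventually (\<lambda>r. c \<le> gauss_norm r h) at_top"
proof -
  obtain j where j: "h $ j \<noteq> 0"
    using assms(2) by (auto simp: fps_eq_iff)
  show ?thesis
  proof
    show "v (h $ j) > 0"
      using j by (rule v_pos)
    show "eventually (\<lambda>r. v (h $ j) \<le> gauss_norm r h) at_top"
      using eventually_ge_at_top[of 1]
    proof eventually_elim
      case (elim r)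
      then have "v (h $ j) * 1 \<le> v (h $ j) * r ^ j"
        by (intro mult_left_mono one_le_power v_nonneg)
      also have "\<dots> \<le> gauss_norm r h"
        using elim assms(1) by (intro v_nth_le_gauss_norm) auto
      finally show ?case
        by simp
    qed
  qed
qed

end

section \<open>Condition (M)\<close>

lemma rat_num_den:
  shows "P = Fract (rat_num P) (rat_den P)" "coprime (rat_num P) (rat_den P)"
    "lead_coeff (rat_den P) = 1" "rat_den P \<noteq> 0"
proof -
  have "case rat_reduced P of (R, S) \<Rightarrow> P = Fract R S \<and> coprime R S \<and> lead_coeff S = 1"
    unfolding rat_reduced_def by (rule theI') (rule rat_reduced_ex1)
  then show "P = Fract (rat_num P) (rat_den P)" "coprime (rat_num P) (rat_den P)"
    and 1: "lead_coeff (rat_den P) = 1"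
    unfolding rat_num_def rat_den_def by (auto split: prod.splits)
  show "rat_den P \<noteq> 0"
    using 1 by auto
qed

lemma rat_num_den_eqI:
  assumes "P = Fract R S" "coprime R S" "lead_coeff S = 1"
  shows "rat_num P = R" "rat_den P = S"
proof -
  have "rat_reduced P = (R, S)"
    unfolding rat_reduced_def by (rule the1_equality[OF rat_reduced_ex1]) (use assms in simp)
  then show "rat_num P = R" "rat_den P = S"
    by (simp_all add: rat_num_def rat_den_def)
qed

lemma double_root_dvd:
  fixes p :: "'a::field poly"
  assumes "poly p c = 0" "poly (pderiv p) c = 0"
  shows "[:- c, 1:]\<^sup>2 dvd p"
proof -
  obtain q where q: "p = [:- c, 1:] * q"
    using assms(1) by (auto simp: poly_eq_0_iff_dvd)
  have "poly q c = 0"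
    using assms(2) unfolding q by (simp add: pderiv_mult pderiv_pCons del: mult_pCons_left)
  then obtain r where "q = [:- c, 1:] * r"
    by (auto simp: poly_eq_0_iff_dvd)
  then show ?thesis
    unfolding q power2_eq_square by (metis dvd_triv_left mult.assoc)
qed

lemma rat_deriv_nonzero_imp:
  "rat_deriv P \<noteq> 0 \<Longrightarrow>
    pderiv (rat_num P) * rat_den P - rat_num P * pderiv (rat_den P) \<noteq> 0"
  unfolding rat_deriv_def using rat_num_den(4)[of P] by (auto simp: eq_fract fract_collapse)

lemma rat_degree_pos:
  assumes "rat_deriv P \<noteq> 0"
  shows "rat_degree P > 0"
proof (rule ccontr)
  assume "\<not> rat_degree P > 0"
  then have "pderiv (rat_num P) = 0" "pderiv (rat_den P) = 0"
    unfolding rat_degree_def by (auto elim!: degree_eq_zeroE simp: pderiv_pCons)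
  then show False
    using rat_deriv_nonzero_imp[OF assms] by simp
qed

text \<open>At a point where \<open>S\<close> does not vanish, \<open>R - P(c) S\<close> has value 0
  and derivative \<open>(R' S - R S') / S\<close>, which vanishes together with the numerator of
  \<open>P'\<close>.\<close>

lemma rat_deriv_zero_double_root:
  assumes "c \<in> rat_zeros (rat_deriv P)" "rat_regular_at P c"
  shows "[:- c, 1:]\<^sup>2 dvd rat_num P - smult (rat_value P c) (rat_den P)"
proof (rule double_root_dvd)
  let ?R = "rat_num P" and ?S = "rat_den P"
  let ?n = "rat_num (rat_deriv P)" and ?d = "rat_den (rat_deriv P)"
  have S: "poly ?S c \<noteq> 0"
    using assms(2) by (simp add: rat_regular_at_def)
  have nd: "poly ?d c \<noteq> 0" "poly ?n c = 0"
    using assms(1) by (auto simp: rat_zeros_def rat_regular_at_def rat_value_def)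
  have "Fract (pderiv ?R * ?S - ?R * pderiv ?S) (?S\<^sup>2) = Fract ?n ?d"
    using rat_num_den(1)[of "rat_deriv P"] unfolding rat_deriv_def by simp
  \<comment> \<open>The zeros of \<open>P'\<close> are defined through its reduced form;
    cross-multiplication transfers them to the unreduced numerator.\<close>
  then have "(pderiv ?R * ?S - ?R * pderiv ?S) * ?d = ?n * ?S\<^sup>2"
    using rat_num_den(4)[of P] rat_num_den(4)[of "rat_deriv P"] by (simp add: eq_fract)
  then have "poly ((pderiv ?R * ?S - ?R * pderiv ?S) * ?d) c = 0"
    using nd by simp
  then have "poly (pderiv ?R) c * poly ?S c = poly ?R c * poly (pderiv ?S) c"
    using nd by simp
  then show "poly (pderiv (?R - smult (rat_value P c) ?S)) c = 0"
    using S by (simp add: pderiv_diff pderiv_smult rat_value_def field_simps)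
  show "poly (?R - smult (rat_value P c) ?S) c = 0"
    using S by (simp add: rat_value_def)
qed

text \<open>By clause (3) of Condition (M), at every zero of \<open>pderiv U\<close> the denominator
  \<open>W\<close> does not vanish and \<open>V / W\<close> differs from \<open>P(c)\<close>, so
  \<open>U\<close> does not vanish there.\<close>

lemma condition_M_coprime:
  fixes P Q :: "'k::alg_closed_field poly fract"
  assumes "condition_M P Q" "c \<in> rat_zeros (rat_deriv P)"
  defines "U \<equiv> rat_num Q - smult (rat_value P c) (rat_den Q)"
  shows "coprime U (pderiv U)"
proof -
  obtain V W where VW: "Q = Fract V W" "lead_coeff W = 1" "coprime V W"
    and M: "\<And>d. poly (pderiv V - smult (rat_value P c) (pderiv W)) d = 0 \<Longrightarrow>
      poly W d \<noteq> 0 \<and> rat_value Q d \<noteq> rat_value P c"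
    using assms(1,2) unfolding condition_M_def Let_def by blast
  have VW': "rat_num Q = V" "rat_den Q = W"
    by (rule rat_num_den_eqI; fact)+
  have root: "poly U d \<noteq> 0" if "poly (pderiv U) d = 0" for d
    using M[of d] that unfolding U_def rat_value_def VW'
    by (auto simp: pderiv_diff pderiv_smult)
  show ?thesis
  proof (rule coprime_if_no_common_root)
    \<comment> \<open>If \<open>U\<close> were 0, it and its derivative would both vanish at the
      point 0, contrary to \<open>root\<close>.\<close>
    show "U \<noteq> 0"
      using root[of 0] by auto
  qed (use root in blast)
qed

context complete_nonarch_field
begin

section \<open>The functional equation\<close>

text \<open>The chain rule \<open>P'(F) F' = Q'(G) G'\<close> with denominators cleared; the factors
  multiplying \<open>F'\<close> and \<open>G'\<close> are nonzero because \<open>F\<close> and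
  \<open>G\<close> are nonconstant.\<close>

lemma deriv_eq_0_iff:
  assumes F: "F \<in> \<A>" "F \<notin> range fps_const" and G: "G \<in> \<A>" "G \<notin> range fps_const"
    and eq: "fps_poly R F * fps_poly W G = fps_poly V G * fps_poly S F"
    and nz: "S \<noteq> 0" "W \<noteq> 0" "pderiv R * S - R * pderiv S \<noteq> 0" "pderiv V * W - V * pderiv W \<noteq> 0"
  shows "fps_deriv F = 0 \<longleftrightarrow> fps_deriv G = 0"
proof -
  have "fps_deriv (fps_poly R F * fps_poly W G) = fps_deriv (fps_poly V G * fps_poly S F)"
    by (simp only: eq)
  then have "fps_poly R F * (fps_poly (pderiv W) G * fps_deriv G)
        + fps_poly (pderiv R) F * fps_deriv F * fps_poly W G
      = fps_poly V G * (fps_poly (pderiv S) F * fps_deriv F)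
        + fps_poly (pderiv V) G * fps_deriv G * fps_poly S F"
    by (simp only: fps_deriv_mult fps_deriv_fps_poly)
  with eq have "(fps_poly (pderiv R) F * fps_poly S F - fps_poly R F * fps_poly (pderiv S) F)
        * (fps_poly W G)\<^sup>2 * fps_deriv F
      = (fps_poly (pderiv V) G * fps_poly W G - fps_poly V G * fps_poly (pderiv W) G)
        * (fps_poly S F)\<^sup>2 * fps_deriv G"
    by algebra
  then have "fps_poly (pderiv R * S - R * pderiv S) F * (fps_poly W G)\<^sup>2 * fps_deriv F
      = fps_poly (pderiv V * W - V * pderiv W) G * (fps_poly S F)\<^sup>2 * fps_deriv G"
    by simp
  moreover have "fps_poly (pderiv R * S - R * pderiv S) F \<noteq> 0"
    "fps_poly (pderiv V * W - V * pderiv W) G \<noteq> 0" "fps_poly W G \<noteq> 0" "fps_poly S F \<noteq> 0"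
    by (rule fps_poly_nonzero[OF F nz(3)] fps_poly_nonzero[OF G nz(4)]
      fps_poly_nonzero[OF G nz(2)] fps_poly_nonzero[OF F nz(1)])+
  ultimately show ?thesis
    by (metis mult_eq_0_iff power_not_zero)
qed

text \<open>Descent: if the derivatives vanish, both functions are series in a power of the variable
  with exponent the characteristic, and the equation passes to the inner series. The index
  \<open>j\<close> of a nonzero coefficient is divided by the characteristic each time, so the
  process stops.\<close>

lemma common_ramification:
  assumes nz: "S \<noteq> 0" "W \<noteq> 0" "pderiv R * S - R * pderiv S \<noteq> 0" "pderiv V * W - V * pderiv W \<noteq> 0"
  assumes "f \<in> \<A>" "g \<in> \<A>" "g \<notin> range fps_const" "f $ j \<noteq> 0" "j > 0"
    and "fps_poly R f * fps_poly W g = fps_poly V g * fps_poly S f"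
  shows "\<exists>t F G. f = F oo fps_X ^ (char_exponent TYPE('k) ^ t)
    \<and> g = G oo fps_X ^ (char_exponent TYPE('k) ^ t)
    \<and> fps_deriv F \<noteq> 0 \<and> fps_deriv G \<noteq> 0
    \<and> fps_poly R F * fps_poly W G = fps_poly V G * fps_poly S F
    \<and> (CHAR('k) = 0 \<longrightarrow> t = 0)"
  using assms(5-)
proof (induction j arbitrary: f g rule: less_induct)
  case (less j)
  have fc: "f \<notin> range fps_const"
    using less.prems by auto
  have iff: "fps_deriv f = 0 \<longleftrightarrow> fps_deriv g = 0"
    using less.prems fc nz by (intro deriv_eq_0_iff[where R = R and V = V]) auto
  show ?case
  proof (cases "fps_deriv f = 0")
    case False
    have "h oo fps_X ^ (char_exponent TYPE('k) ^ 0) = h" for h :: "'k fps"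
      by (rule fps_ext) (simp add: fps_nth_compose_X_power)
    then show ?thesis
      using False iff less.prems by metis
  next
    case True
    define n where "n = CHAR('k)"
    obtain f' where f': "f = f' oo fps_X ^ n"
      unfolding n_def using fps_deriv_eq_0_imp_compose[OF True] .
    obtain g' where g': "g = g' oo fps_X ^ n"
      unfolding n_def using fps_deriv_eq_0_imp_compose True iff by metis
    have nj: "n dvd j" "f' $ (j div n) \<noteq> 0"
      using less.prems(4) unfolding f' by (auto simp: fps_nth_compose_X_power split: if_splits)
    \<comment> \<open>A positive multiple \<open>j\<close> of \<open>n\<close> rules out
      \<open>n = 0\<close>, so this case occurs only in positive characteristic.\<close>
    then have n0: "n > 0"
      using less.prems(5) by (auto intro: gr0I)
    then have "n > 1"
      using prime_CHAR_semidom[where ?'a = 'k] unfolding n_def by (intro prime_gt_1_nat) auto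
    have e: "char_exponent TYPE('k) = n"
      using n0 by (simp add: char_exponent_def n_def)
    have X0: "(fps_X ^ n :: 'k fps) $ 0 = 0"
      using n0 by simp
    have "(fps_poly R f' * fps_poly W g') oo fps_X ^ n = (fps_poly V g' * fps_poly S f') oo fps_X ^ n"
      using less.prems(6) unfolding f' g'
      by (simp add: fps_compose_mult_distrib[OF X0] fps_poly_compose[OF X0])
    then have eq: "fps_poly R f' * fps_poly W g' = fps_poly V g' * fps_poly S f'"
      using n0 by (rule compose_X_power_inj)
    have "\<exists>t F G. f' = F oo fps_X ^ (char_exponent TYPE('k) ^ t)
      \<and> g' = G oo fps_X ^ (char_exponent TYPE('k) ^ t)
      \<and> fps_deriv F \<noteq> 0 \<and> fps_deriv G \<noteq> 0
      \<and> fps_poly R F * fps_poly W G = fps_poly V G * fps_poly S F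
      \<and> (CHAR('k) = 0 \<longrightarrow> t = 0)"
    proof (rule less.IH[of "j div n"])
      show "j div n < j" "0 < j div n"
        using nj(1) \<open>n > 1\<close> less.prems(5) by (auto elim!: dvdE)
      show "f' \<in> \<A>" "g' \<in> \<A>"
        using less.prems n0 unfolding f' g' by (blast intro: entire_of_compose_X_power)+
      show "g' \<notin> range fps_const"
        using less.prems(3) unfolding g' by auto
    qed (fact nj eq)+
    then obtain t F G where *: "f' = F oo fps_X ^ (n ^ t)" "g' = G oo fps_X ^ (n ^ t)"
      "fps_deriv F \<noteq> 0" "fps_deriv G \<noteq> 0"
      "fps_poly R F * fps_poly W G = fps_poly V G * fps_poly S F"
      unfolding e by blast
    have "f = F oo fps_X ^ (char_exponent TYPE('k) ^ Suc t)"
      "g = G oo fps_X ^ (char_exponent TYPE('k) ^ Suc t)"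
      unfolding f' g' * e using n0 by (simp_all add: compose_X_power_power)
    moreover have "CHAR('k) \<noteq> 0"
      using n0 by (simp add: n_def)
    ultimately show ?thesis
      using *(3-5) by (intro exI[of _ "Suc t"] exI[of _ F] exI[of _ G] conjI impI) (assumption | blast)+
  qed
qed

text \<open>By Bezout, \<open>(F - c)\<^sup>2\<close> divides \<open>U(G)\<close> for the squarefree polynomial \<open>U = V - w W\<close>. Hence
  \<open>F - c\<close> divides \<open>U'(G) G'\<close>, and since it also divides \<open>U(G)\<close>, it divides \<open>G'\<close>.\<close>

lemma linear_dvd_deriv:
  assumes F: "F \<in> \<A>" and G: "G \<in> \<A>"
    and eq: "fps_poly R F * fps_poly W G = fps_poly V G * fps_poly S F"
    and c: "poly S c \<noteq> 0" "[:- c, 1:]\<^sup>2 dvd R - smult w S"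
    and U: "coprime (V - smult w W) (pderiv (V - smult w W))"
  shows "\<exists>h\<in>\<A>. fps_deriv G = (F - fps_const c) * h"
proof -
  define U where "U = V - smult w W"
  define a where "a = F - fps_const c"
  have a: "a \<in> \<A>"
    using F by (simp add: a_def)
  obtain T where T: "R - smult w S = [:- c, 1:]\<^sup>2 * T"
    using c(2) by (auto elim!: dvdE)
  have RT: "fps_poly R F - fps_const w * fps_poly S F = a\<^sup>2 * fps_poly T F"
    using arg_cong[OF T, of "\<lambda>U. fps_poly U F"] by (simp add: a_def del: mult_pCons_left fps_poly_pCons)
  have "coprime ([:- c, 1:]\<^sup>2) S"
    using c(1) by (intro coprime_if_no_common_root) auto
  then have "coprime S ([:- c, 1:]\<^sup>2)"
    by (simp only: coprime_commute)
  then obtain x y where xy: "x * S + y * [:- c, 1:]\<^sup>2 = 1"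
    by (rule poly_bezout)
  have xy': "fps_poly x F * fps_poly S F + fps_poly y F * a\<^sup>2 = 1"
    using arg_cong[OF xy, of "\<lambda>U. fps_poly U F"] by (simp add: a_def del: mult_pCons_left fps_poly_pCons)
  \<comment> \<open>Multiply the Bezout identity \<open>xy'\<close> by \<open>U(G)\<close> and use
    \<open>U(G) S(F) = a^2 T(F) W(G)\<close>, which follows from the functional equation and
    \<open>RT\<close>.\<close>
  define h where "h = fps_poly x F * fps_poly T F * fps_poly W G + fps_poly y F * fps_poly U G"
  have UG: "fps_poly U G = fps_poly V G - fps_const w * fps_poly W G"
    by (simp add: U_def)
  have h: "fps_poly U G = a\<^sup>2 * h"
    using eq RT xy' unfolding UG h_def by algebra
  obtain z z' where zz: "z * U + z' * pderiv U = 1"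
    using poly_bezout U unfolding U_def by metis
  have zz': "fps_poly z G * fps_poly U G + fps_poly z' G * fps_poly (pderiv U) G = 1"
    using arg_cong[OF zz, of "\<lambda>U. fps_poly U G"] by simp
  have dU: "fps_poly (pderiv U) G * fps_deriv G
      = a * (2 * fps_deriv a * h + a * fps_deriv h)"
    using arg_cong[OF h, of fps_deriv]
    by (simp add: fps_deriv_fps_poly power2_eq_square algebra_simps)
  \<comment> \<open>The second Bezout identity \<open>zz'\<close> multiplied by \<open>G'\<close>;
    both summands carry a factor \<open>a\<close>.\<close>
  have "fps_deriv G = a * (fps_poly z G * a * h * fps_deriv G
      + fps_poly z' G * (2 * fps_deriv a * h + a * fps_deriv h))"
    using zz' dU h by algebra
  moreover have "h \<in> \<A>"
    unfolding h_def using F G by simp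
  moreover have "(2 :: 'k fps) \<in> \<A>"
    using entire_const[of 2] by (simp add: numeral_fps_const)
  ultimately show ?thesis
    using a F G unfolding a_def[symmetric]
    by (intro bexI[of _ "fps_poly z G * a * h * fps_deriv G
      + fps_poly z' G * (2 * fps_deriv a * h + a * fps_deriv h)"]) auto
qed

text \<open>Distinct constants \<open>c\<close> give coprime linear polynomials, and the Bezout
  identities carry over to entire functions by substituting \<open>F\<close>.\<close>

lemma linear_prod_dvd:
  assumes "finite C" "F \<in> \<A>" "D \<in> \<A>" "\<And>c. c \<in> C \<Longrightarrow> \<exists>h\<in>\<A>. D = (F - fps_const c) * h"
  shows "\<exists>h\<in>\<A>. D = (\<Prod>c\<in>C. F - fps_const c) * h"
  using assms(1,4)
proof (induction C rule: finite_induct)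
  case (insert c C)
  then obtain h k where h: "h \<in> \<A>" "D = (\<Prod>c\<in>C. F - fps_const c) * h"
    and k: "k \<in> \<A>" "D = (F - fps_const c) * k"
    by blast
  define p where "p = (\<Prod>c\<in>C. F - fps_const c)"
  have "coprime [:- c, 1:] (\<Prod>c\<in>C. [:- c, 1:])"
    using insert by (intro coprime_if_no_common_root) (auto simp: poly_prod)
  then obtain x y where xy: "x * [:- c, 1:] + y * (\<Prod>c\<in>C. [:- c, 1:]) = 1"
    using poly_bezout by metis
  have "fps_poly x F * (F - fps_const c) + fps_poly y F * p = 1"
    using arg_cong[OF xy, of "\<lambda>U. fps_poly U F"] unfolding p_def
    by (simp add: fps_poly_prod del: mult_pCons_left mult_pCons_right fps_poly_pCons)
  with h(2)[folded p_def] k(2)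
  have "D = ((F - fps_const c) * p) * (fps_poly x F * h + fps_poly y F * k)"
    by algebra
  then show ?case
    using insert(1,2) h(1) k(1) assms(2) unfolding p_def
    by (intro bexI[of _ "fps_poly x F * h + fps_poly y F * k"]) auto
qed (use assms in auto)

section \<open>Growth forced by the functional equation\<close>

text \<open>The cofactor \<open>h\<close> is a nonzero entire function, so its Gauss norm is
  eventually bounded below, and a factor outgrows the product by at most a constant. With
  \<open>p\<close> in place of \<open>degree R\<close> the bound serves numerator and denominator
  alike.\<close>

lemma gauss_norm_le_of_dvd:
  assumes F: "F \<in> \<A>" "F \<notin> range fps_const" and G: "G \<in> \<A>" "G \<notin> range fps_const"
    and "fps_poly R F = fps_poly V G * h" "h \<in> \<A>" "R \<noteq> 0" "degree R \<le> p"
  obtains K where "K > 0" "eventually (\<lambda>r. gauss_norm r G ^ degree V \<le> K * gauss_norm r F ^ p) at_top"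
proof -
  have nz: "V \<noteq> 0" "h \<noteq> 0"
    using fps_poly_nonzero[OF F assms(7)] assms(5) by auto
  obtain a where a: "a > 0"
    "eventually (\<lambda>r. a * gauss_norm r G ^ degree V \<le> gauss_norm r (fps_poly V G)) at_top"
    using gauss_norm_fps_poly_ge[OF G nz(1)] .
  obtain b where b: "b > 0"
    "eventually (\<lambda>r. gauss_norm r (fps_poly R F) \<le> b * gauss_norm r F ^ degree R) at_top"
    using gauss_norm_fps_poly_le[OF F] .
  obtain e where e: "e > 0" "eventually (\<lambda>r. e \<le> gauss_norm r h) at_top"
    using gauss_norm_ge_const[OF assms(6) nz(2)] .
  have "eventually (\<lambda>r. 1 \<le> gauss_norm r F) at_top"
    using gauss_norm_at_top[OF F] by (auto simp: filterlim_at_top)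
  then have "eventually (\<lambda>r. gauss_norm r G ^ degree V \<le> b / (a * e) * gauss_norm r F ^ p) at_top"
    using a(2) b(2) e(2) eventually_gt_at_top[of 0]
  proof eventually_elim
    case (elim r)
    have "gauss_norm r G \<ge> 0"
      using G(1) elim(5) by (rule gauss_norm_nonneg)
    then have "a * gauss_norm r G ^ degree V * e \<le> gauss_norm r (fps_poly V G) * gauss_norm r h"
      using elim a(1) e(1) G(1) by (intro mult_mono gauss_norm_nonneg) auto
    also have "\<dots> = gauss_norm r (fps_poly R F)"
      using elim F G assms(5,6) by (simp add: gauss_norm_mult)
    also have "\<dots> \<le> b * gauss_norm r F ^ degree R"
      by (rule elim)
    also have "\<dots> \<le> b * gauss_norm r F ^ p"
      using b(1) elim assms(8) by (intro mult_left_mono power_increasing) auto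
    finally show ?case
      using a(1) e(1) by (simp add: field_simps)
  qed
  moreover have "b / (a * e) > 0"
    using a b e by simp
  ultimately show ?thesis
    using that by blast
qed

lemma functional_equation_growth:
  assumes F: "F \<in> \<A>" "F \<notin> range fps_const" and G: "G \<in> \<A>" "fps_deriv G \<noteq> 0"
    and eq: "fps_poly R F * fps_poly W G = fps_poly V G * fps_poly S F"
    and RS: "coprime R S" "R \<noteq> 0" "S \<noteq> 0" and VW: "coprime V W"
    and C: "finite C" "\<And>c. c \<in> C \<Longrightarrow> poly S c \<noteq> 0"
      "\<And>c. c \<in> C \<Longrightarrow> [:- c, 1:]\<^sup>2 dvd R - smult (w c) S"
      "\<And>c. c \<in> C \<Longrightarrow> coprime (V - smult (w c) W) (pderiv (V - smult (w c) W))"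
    and kpq: "k = card C" "p = max (degree R) (degree S)" "q = max (degree V) (degree W)" "q > 0"
  obtains c where "k * q < p" "c > 0"
    "eventually (\<lambda>r. c * r ^ q \<le> gauss_norm r F ^ (p - k * q)) at_top"
proof -
  note Gc = fps_const_iff_deriv_nonzero[OF G(2)]
  obtain x y where xy: "x * V + y * W = 1"
    using poly_bezout[OF VW] by metis
  have xy': "fps_poly x G * fps_poly V G + fps_poly y G * fps_poly W G = 1"
    using arg_cong[OF xy, of "\<lambda>U. fps_poly U G"] by simp
  \<comment> \<open>Bezout for \<open>V\<close> and \<open>W\<close> yields one cofactor for both
    divisibilities: times \<open>V(G)\<close> it is \<open>R(F)\<close>, times \<open>W(G)\<close>
    it is \<open>S(F)\<close>.\<close>
  have h1: "fps_poly R F = fps_poly V G * (fps_poly x G * fps_poly R F + fps_poly y G * fps_poly S F)"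
    using eq xy' by algebra
  have h2: "fps_poly S F = fps_poly W G * (fps_poly x G * fps_poly R F + fps_poly y G * fps_poly S F)"
    using eq xy' by algebra
  obtain K1 where K1: "K1 > 0"
    "eventually (\<lambda>r. gauss_norm r G ^ degree V \<le> K1 * gauss_norm r F ^ p) at_top"
    by (rule gauss_norm_le_of_dvd[OF F G(1) Gc h1, of p]) (use F G RS kpq in auto)
  obtain K2 where K2: "K2 > 0"
    "eventually (\<lambda>r. gauss_norm r G ^ degree W \<le> K2 * gauss_norm r F ^ p) at_top"
    by (rule gauss_norm_le_of_dvd[OF F G(1) Gc h2, of p]) (use F G RS kpq in auto)
  obtain K where K: "K > 0" "eventually (\<lambda>r. gauss_norm r G ^ q \<le> K * gauss_norm r F ^ p) at_top"
  proof (cases "degree W \<le> degree V")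
    case True
    then show ?thesis
      using that[OF K1(1)] K1(2) kpq(3) by (simp add: max_absorb1)
  next
    case False
    then show ?thesis
      using that[OF K2(1)] K2(2) kpq(3) by (simp add: max_absorb2)
  qed
  have "\<exists>h\<in>\<A>. fps_deriv G = (\<Prod>c\<in>C. F - fps_const c) * h"
    using F G C eq by (intro linear_prod_dvd linear_dvd_deriv) auto
  then obtain h where h: "h \<in> \<A>" "fps_deriv G = (\<Prod>c\<in>C. F - fps_const c) * h"
    by blast
  have "h \<noteq> 0"
    using h(2) G(2) by auto
  then obtain e where e: "e > 0" "eventually (\<lambda>r. e \<le> gauss_norm r h) at_top"
    using gauss_norm_ge_const[OF h(1)] by metis
  have F_ge: "eventually (\<lambda>r. b \<le> gauss_norm r F) at_top" for b
    using gauss_norm_at_top[OF F] by (auto simp: filterlim_at_top)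
  have "eventually (\<lambda>r. \<forall>c\<in>C. v c + 1 \<le> gauss_norm r F) at_top"
    by (intro eventually_ball_finite C(1) ballI F_ge)
  then have main: "eventually (\<lambda>r. e ^ q * r ^ q * gauss_norm r F ^ (k * q) \<le> K * gauss_norm r F ^ p) at_top"
    using e(2) K(2) eventually_gt_at_top[of 0]
  proof eventually_elim
    case (elim r)
    have "gauss_norm r (F - fps_const c) = gauss_norm r F" if "c \<in> C" for c
    proof -
      have "v c < gauss_norm r F"
        using bspec[OF elim(1) that] by linarith
      then show ?thesis
        using gauss_norm_add_eq[of "- fps_const c" F r] elim F by (simp del: fps_const_neg)
    qed
    then have "gauss_norm r F ^ k * gauss_norm r h = gauss_norm r (fps_deriv G)"
      unfolding h(2) using elim F h(1) kpq(1)
      by (simp add: gauss_norm_mult gauss_norm_prod entire_prod)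
    also have "\<dots> \<le> gauss_norm r G / r"
      using G elim by (intro gauss_norm_deriv_le)
    finally have "r * (gauss_norm r F ^ k * gauss_norm r h) \<le> gauss_norm r G"
      using elim by (simp add: field_simps)
    moreover have "e * (r * gauss_norm r F ^ k) \<le> gauss_norm r h * (r * gauss_norm r F ^ k)"
      using elim F by (intro mult_right_mono mult_nonneg_nonneg zero_le_power gauss_norm_nonneg) auto
    ultimately have "e * (r * gauss_norm r F ^ k) \<le> gauss_norm r G"
      by (simp add: mult_ac)
    moreover have "0 \<le> e * (r * gauss_norm r F ^ k)"
      using elim F e(1) by (intro mult_nonneg_nonneg zero_le_power gauss_norm_nonneg) auto
    ultimately have "(e * (r * gauss_norm r F ^ k)) ^ q \<le> gauss_norm r G ^ q"
      by (rule power_mono)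
    also have "\<dots> \<le> K * gauss_norm r F ^ p"
      by (rule elim)
    finally show ?case
      by (simp add: power_mult_distrib power_mult mult_ac)
  qed
  have kqp: "k * q < p"
  proof (rule ccontr)
    assume "\<not> k * q < p"
    then have le: "p \<le> k * q"
      by simp
    \<comment> \<open>If \<open>p \<le> k * q\<close>, the powers of the norm of \<open>F\<close>,
      which is at least 1, on the left absorb those on the right, and the remaining factor
      \<open>r ^ q\<close> with \<open>q > 0\<close> exceeds every constant.\<close>
    have "eventually (\<lambda>r::real. False) at_top"
      using main F_ge[of 1] eventually_gt_at_top[of "K / e ^ q"] eventually_ge_at_top[of 1]
    proof eventually_elim
      case (elim r)
      have "e ^ q * r ^ 1 \<le> e ^ q * r ^ q"
        using elim e(1) kpq(4) by (intro mult_left_mono power_increasing) auto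
      moreover have "K < e ^ q * r"
        using elim e(1) by (simp add: field_simps)
      ultimately have "K < e ^ q * r ^ q"
        by simp
      then have "K * gauss_norm r F ^ p < e ^ q * r ^ q * gauss_norm r F ^ p"
        using elim by (intro mult_strict_right_mono) auto
      also have "\<dots> \<le> e ^ q * r ^ q * gauss_norm r F ^ (k * q)"
        using elim e(1) le by (intro mult_left_mono power_increasing) auto
      finally show False
        using elim by simp
    qed
    then show False
      by simp
  qed
  have "eventually (\<lambda>r. e ^ q / K * r ^ q \<le> gauss_norm r F ^ (p - k * q)) at_top"
    using main F_ge[of 1]
  proof eventually_elim
    case (elim r)
    have "gauss_norm r F ^ p = gauss_norm r F ^ (p - k * q) * gauss_norm r F ^ (k * q)"
      using kqp by (simp flip: power_add)
    then have "e ^ q * r ^ q * gauss_norm r F ^ (k * q)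
        \<le> K * gauss_norm r F ^ (p - k * q) * gauss_norm r F ^ (k * q)"
      using elim by simp
    moreover have "gauss_norm r F ^ (k * q) > 0"
      using elim by simp
    ultimately have "e ^ q * r ^ q \<le> K * gauss_norm r F ^ (p - k * q)"
      by (rule mult_right_le_imp_le)
    then show ?case
      using K(1) by (simp add: field_simps)
  qed
  moreover have "e ^ q / K > 0"
    using e K by simp
  ultimately show ?thesis
    using kqp that by blast
qed

section \<open>From growth to a lower bound for the Nevanlinna function\<close>

text \<open>Growth of this order needs at least \<open>b / a\<close> zeros. A polynomial of degree
  \<open>m\<close> has Gauss norm \<open>K * r ^ m\<close> for large \<open>r\<close>, which forces
  \<open>b \<le> m * a\<close>; otherwise \<open>b\<close> zeros can be split off, and
  \<open>a \<ge> 1\<close>. These zeros alone bound \<open>nev_Z\<close>, hence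
  \<open>nev_T\<close>, from below.\<close>

lemma nev_T_growth:
  assumes f: "f \<in> \<A>" "f $ 0 \<noteq> 0" and ab: "a > 0" "b > 0"
    and c: "c > 0" "eventually (\<lambda>r. c * r ^ b \<le> gauss_norm r f ^ a) at_top"
  obtains C r where "r > 0"
    "\<And>\<rho>. \<rho> \<ge> r \<Longrightarrow> ln \<rho> \<le> real a / real b * nev_T v \<rho> (fps_to_fls f) + C"
proof -
  obtain xs h where xs: "f = (\<Prod>x\<leftarrow>xs. fps_X - fps_const x) * h" "h \<in> \<A>" "b \<le> length xs * a"
  proof -
    from f(1) show ?thesis
    proof (cases rule: entire_factorization[where m = b])
      case (zeros xs h)
      then show ?thesis
        using that ab(1) by simp
    next
      case (poly xs d)
      define m where "m = length xs"
      define E where "E = (\<Prod>x\<leftarrow>xs. fps_X - fps_const x)"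
      define K where "K = v (E $ m) * v d"
      define R where "R = Max (insert 1 (v ` set xs))"
      have Rx: "v x \<le> R" if "x \<in> set xs" for x
        unfolding R_def using that by (intro Max_ge) auto
      have E: "E \<in> \<A>"
        unfolding E_def by (rule entire_prod_list) auto
      have norm: "gauss_norm r f = K * r ^ m" if "r \<ge> R" "r > 0" for r
      proof -
        have "dominant_index r E m"
          unfolding E_def m_def using that Rx by (intro dominant_index_linear_prod) (auto intro: order_trans)
        then show ?thesis
          using that E poly(2) by (simp add: gauss_norm_mult gauss_norm_dominant K_def mult_ac flip: E_def)
      qed
      have "b \<le> m * a"
      proof (rule ccontr)
        assume "\<not> b \<le> m * a"
        then have mb: "m * a + 1 \<le> b"
          by simp
        have "eventually (\<lambda>r::real. False) at_top"
          using c(2) eventually_ge_at_top[of R] eventually_ge_at_top[of 1]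
            eventually_gt_at_top[of "K ^ a / c"]
        proof eventually_elim
          case (elim r)
          have "c * r ^ (m * a + 1) \<le> c * r ^ b"
            using elim mb c(1) by (intro mult_left_mono power_increasing) auto
          also have "\<dots> \<le> K ^ a * r ^ (m * a)"
            using elim norm[of r] by (simp add: power_mult_distrib power_mult)
          finally have "c * r * r ^ (m * a) \<le> K ^ a * r ^ (m * a)"
            by (simp add: mult_ac)
          moreover have "r ^ (m * a) > 0"
            using elim by simp
          ultimately have "c * r \<le> K ^ a"
            by (rule mult_right_le_imp_le)
          then show False
            using elim c(1) by (simp add: field_simps)
        qed
        then show False
          by simp
      qed
      then show ?thesis
        using that poly(2) by (simp add: m_def)
    qed
  qed
  obtain r C where C: "r > 0"
    "\<And>\<rho>. \<rho> \<ge> r \<Longrightarrow> nev_Z v \<rho> (fps_to_fls f) \<ge> real (length xs) * ln \<rho> - C"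
    by (rule nev_Z_ge[OF xs(2,1) f(2)], rule that) blast+
  define s where "s = real a / real b"
  have s: "s \<ge> 0" "1 \<le> s * real (length xs)"
    using ab xs(3) unfolding s_def by (simp_all add: field_simps flip: of_nat_mult)
  show ?thesis
  proof
    show "max r 1 > 0"
      by simp
    fix \<rho> assume \<rho>: "\<rho> \<ge> max r 1"
    have "1 * ln \<rho> \<le> s * real (length xs) * ln \<rho>"
      using s \<rho> by (intro mult_right_mono) auto
    also have "\<dots> = s * (real (length xs) * ln \<rho> - C) + s * C"
      by (simp add: algebra_simps)
    also have "\<dots> \<le> s * nev_T v \<rho> (fps_to_fls f) + s * C"
      using C(2)[of \<rho>] \<rho> s(1) by (intro add_right_mono mult_left_mono) (auto simp: nev_T_def)
    finally show "ln \<rho> \<le> real a / real b * nev_T v \<rho> (fps_to_fls f) + s * C"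
      by (simp add: s_def)
  qed
qed

end

section \<open>The inequality for the Nevanlinna function and its bounded remainder\<close>

theorem theorem2p2p4:
  fixes v :: "'k::alg_closed_field \<Rightarrow> real"
    and P Q :: "'k poly fract"
    and f g :: "'k fps"
    and k p q t :: nat
    and \<rho>\<^sub>0 :: real
  assumes "complete_nonarch_field v"
    and "condition_M P Q"
    and "k = card (rat_zeros (rat_deriv P))"
    and "p = rat_degree P"
    and "q = rat_degree Q"
    and "f \<in> entire_functions v" and "f \<notin> range fps_const"
    and "g \<in> entire_functions v" and "g \<notin> range fps_const"
    and "fps_nth f 0 \<noteq> 0"
    and "rat_compose P (fps_to_fls f) = rat_compose Q (fps_to_fls g)"
    and "t = ramification_index v (fps_to_fls f)"
    and "\<rho>\<^sub>0 > 0"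
  shows "ramification_index v (fps_to_fls g) = t \<and>
    (\<exists>B :: real \<Rightarrow> real. bounded (B ` {\<rho>\<^sub>0..}) \<and>
      (\<forall>\<rho>\<in>{\<rho>\<^sub>0..}.
        0 \<ge> (real k * real q - real p) / (real (char_exponent TYPE('k)) ^ t * real q)
              * nev_T v \<rho> (fps_to_fls f) + ln \<rho> + B \<rho>)) \<and>
    int q * int k - int p < 0"
proof -
  interpret complete_nonarch_field v
    by fact
  define C where "C = rat_zeros (rat_deriv P)"
  define R S V W where "R = rat_num P" and "S = rat_den P" and "V = rat_num Q" and "W = rat_den Q"
  have "rat_deriv P * rat_deriv Q \<noteq> 0" "card C > 0" "\<And>c. c \<in> C \<Longrightarrow> rat_regular_at P c"
    using assms(2) unfolding condition_M_def Let_def C_def by blast+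
  then have dP: "rat_deriv P \<noteq> 0" and dQ: "rat_deriv Q \<noteq> 0" and C: "finite C"
    and reg: "\<And>c. c \<in> C \<Longrightarrow> rat_regular_at P c"
    by (auto intro: card_ge_0_finite)
  have N: "pderiv R * S - R * pderiv S \<noteq> 0" "pderiv V * W - V * pderiv W \<noteq> 0"
    unfolding R_def S_def V_def W_def using dP dQ by (blast dest: rat_deriv_nonzero_imp)+
  have nz: "S \<noteq> 0" "W \<noteq> 0"
    unfolding S_def W_def by (rule rat_num_den)+
  have Rnz: "R \<noteq> 0"
    using N(1) by auto
  have "fps_to_fls (fps_poly R f) / fps_to_fls (fps_poly S f)
      = fps_to_fls (fps_poly V g) / fps_to_fls (fps_poly W g)"
    using assms(11) unfolding rat_compose_def poly_map_fls_const R_def S_def V_def W_def .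
  moreover have "fps_poly S f \<noteq> 0" "fps_poly W g \<noteq> 0"
    using assms nz by (intro fps_poly_nonzero; simp)+
  ultimately have "fps_to_fls (fps_poly R f) * fps_to_fls (fps_poly W g)
      = fps_to_fls (fps_poly V g) * fps_to_fls (fps_poly S f)"
    by (simp add: field_simps)
  then have eq: "fps_poly R f * fps_poly W g = fps_poly V g * fps_poly S f"
    by (simp only: fps_to_fls_eq_iff flip: fls_times_fps_to_fls)
  have "f \<noteq> fps_const (f $ 0)"
    using assms(7) by blast
  then obtain j where "f $ j \<noteq> fps_const (f $ 0) $ j"
    by (auto simp: fps_eq_iff)
  then have j: "j > 0" "f $ j \<noteq> 0"
    by (cases j; simp)+
  obtain s F G where s: "f = F oo fps_X ^ (char_exponent TYPE('k) ^ s)"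
    "g = G oo fps_X ^ (char_exponent TYPE('k) ^ s)" "fps_deriv F \<noteq> 0" "fps_deriv G \<noteq> 0"
    "fps_poly R F * fps_poly W G = fps_poly V G * fps_poly S F" "CHAR('k) = 0 \<longrightarrow> s = 0"
    using common_ramification[OF nz N assms(6,8,9) j(2,1) eq]
    by (elim exE conjE) (rule that; assumption)
  \<comment> \<open>Because \<open>F'\<close> and \<open>G'\<close> are nonzero, the common exponent
    \<open>s\<close> is the ramification index of both functions.\<close>
  have ts: "t = s"
    unfolding assms(12) s(1) using assms(6) s by (intro ramification_index_eqI) auto
  have tg: "ramification_index v (fps_to_fls g) = t"
    unfolding ts s(2) using assms(8) s by (intro ramification_index_eqI) auto
  define n where "n = char_exponent TYPE('k) ^ t"
  have n: "n > 0"
    by (simp add: n_def char_exponent_def)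
  note fg = s(1,2)[folded ts, folded n_def]
  have F: "F \<in> \<A>" and G: "G \<in> \<A>"
    using assms(6,8) n unfolding fg by (blast intro: entire_of_compose_X_power)+
  have q: "q > 0"
    unfolding assms(5) using dQ by (rule rat_degree_pos)
  obtain c where kqp: "k * q < p" and c: "c > 0"
    "eventually (\<lambda>r. c * r ^ q \<le> gauss_norm r F ^ (p - k * q)) at_top"
  proof (rule functional_equation_growth[OF F fps_const_iff_deriv_nonzero[OF s(3)] G s(4,5) _ Rnz nz(1)])
    show "coprime R S" "coprime V W"
      unfolding R_def S_def V_def W_def by (rule rat_num_den)+
    show "poly S c \<noteq> 0" if "c \<in> C" for c
      using reg[OF that] by (simp add: rat_regular_at_def S_def)
    show "[:- c, 1:]\<^sup>2 dvd R - smult (rat_value P c) S" if "c \<in> C" for c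
      using that reg[OF that] unfolding C_def R_def S_def by (rule rat_deriv_zero_double_root)
    show "coprime (V - smult (rat_value P c) W) (pderiv (V - smult (rat_value P c) W))"
      if "c \<in> C" for c
      using assms(2) that unfolding C_def V_def W_def by (rule condition_M_coprime)
    show "k = card C" "p = max (degree R) (degree S)" "q = max (degree V) (degree W)"
      using assms(3-5) by (simp_all add: C_def R_def S_def V_def W_def rat_degree_def)
  qed (use C q in auto)
  \<comment> \<open>Since \<open>f(x) = F(x^n)\<close>, the growth estimate for \<open>F\<close> is
    taken at \<open>r ^ n\<close>. This produces the exponent \<open>n * q\<close>, hence the factor
    \<open>\<chi>^t\<close> in the denominator.\<close>
  have "filterlim (\<lambda>r::real. r ^ n) at_top at_top"
    using n by (intro filterlim_pow_at_top filterlim_ident)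
  then have "eventually (\<lambda>r. c * (r ^ n) ^ q \<le> gauss_norm (r ^ n) F ^ (p - k * q)) at_top"
    using c(2) by (rule eventually_compose_filterlim[rotated])
  then have growth: "eventually (\<lambda>r. c * r ^ (n * q) \<le> gauss_norm r f ^ (p - k * q)) at_top"
    using eventually_gt_at_top[of 0]
  proof eventually_elim
    case (elim r)
    have "gauss_norm (r ^ n) F ^ (p - k * q) \<le> gauss_norm r f ^ (p - k * q)"
      using elim n assms(6) F unfolding fg
      by (intro power_mono gauss_norm_compose_X_power_ge) (auto intro: gauss_norm_nonneg)
    then show ?case
      using elim by (simp add: power_mult)
  qed
  have pos: "0 < p - k * q" "0 < n * q"
    using kqp n q by simp_all
  obtain D r where D: "r > 0"
    "\<And>\<rho>. \<rho> \<ge> r \<Longrightarrow> ln \<rho> \<le> real (p - k * q) / real (n * q) * nev_T v \<rho> (fps_to_fls f) + D"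
    by (rule nev_T_growth[OF assms(6,10) pos c(1) growth], rule that) blast+
  define L where "L \<rho> = (real k * real q - real p) / (real (char_exponent TYPE('k)) ^ t * real q)
    * nev_T v \<rho> (fps_to_fls f) + ln \<rho>" for \<rho>
  \<comment> \<open>As \<open>k * q < p\<close>, the truncated difference \<open>p - k * q\<close>
    agrees with the real one.\<close>
  have L: "L \<rho> = ln \<rho> - real (p - k * q) / real (n * q) * nev_T v \<rho> (fps_to_fls f)" for \<rho>
    using kqp unfolding L_def n_def by (simp add: of_nat_diff field_simps diff_divide_distrib)
  \<comment> \<open>For \<open>\<rho> < r\<close> the term with \<open>nev_T\<close> only lowers
    \<open>L \<rho>\<close>, because \<open>k * q < p\<close> and \<open>nev_T\<close> is
    nonnegative; \<open>ln r\<close> bounds the rest.\<close>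
  have L_le: "L \<rho> \<le> max D (ln r)" if "\<rho> \<ge> \<rho>\<^sub>0" for \<rho>
  proof (cases "\<rho> \<ge> r")
    case True
    then show ?thesis
      using D(2)[of \<rho>] by (simp add: L)
  next
    case False
    have "0 \<le> real (p - k * q) / real (n * q) * nev_T v \<rho> (fps_to_fls f)"
      by (intro mult_nonneg_nonneg nev_T_nonneg) auto
    moreover have "ln \<rho> \<le> ln r"
      using False that assms(13) by (subst ln_le_cancel_iff) auto
    ultimately show ?thesis
      by (simp add: L)
  qed
  \<comment> \<open>\<open>B\<close> is minus the positive part of \<open>L\<close>; the upper bound
    on \<open>L\<close> makes it bounded for \<open>\<rho> \<ge> \<rho>\<^sub>0\<close>.\<close>
  define B where "B \<rho> = - max (L \<rho>) 0" for \<rho>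
  have "bounded (B ` {\<rho>\<^sub>0..})"
    unfolding bounded_iff
  proof (intro exI[of _ "max 0 (max D (ln r))"] ballI)
    fix y assume "y \<in> B ` {\<rho>\<^sub>0..}"
    then show "norm y \<le> max 0 (max D (ln r))"
      using L_le by (fastforce simp: B_def)
  qed
  moreover have "0 \<ge> L \<rho> + B \<rho>" for \<rho>
    by (simp add: B_def)
  moreover have "int q * int k - int p < 0"
    using kqp by (simp add: mult.commute flip: of_nat_mult)
  ultimately show ?thesis
    using tg unfolding L_def by blast
qed

end
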